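(* Let $(M,\omega,F)$ be a Finslerian symplectic manifold and let $\tilde{\nabla}$ be the Chern connection of $(M,F)$. Assume that $\tilde{\nabla}$ preserves $\omega$, and that $M$ admits a smooth vector field $W\in\mathcal{X}(M)$ with $W_x\neq 0$ for every $x\in M$. Then there is a nonempty family of symplectic connections on $M$ (with respect to $\omega$); in other words, there is a nonempty family of Fedosov structures $(M,\omega,\nabla)$ on $M$.
   Context: A symplectic manifold $(M,\omega)$ is a smooth manifold $M$ with a nondegenerate closed two-form $\omega$. A linear connection $\nabla$ on $M$ preserves $\omega$ if $Z(\omega(X,Y))=\omega(\nabla_ZX,Y)+\omega(X,\nabla_ZY)$ for all vector fields $X,Y,Z$. A symplectic connection is a symmetric (torsion-free) linear connection on $TM$ preserving $\omega$. A Fedosov manifold (Fedosov structure) is a triple $(M,\omega,\nabla)$ with $(M,\omega)$ symplectic and $\nabla$ a symplectic connection. A Minkowski norm on $\mathbb{R}^m$ is a function $\mathcal F:\mathbb{R}^m\to[0,\infty)$ that is $C^\infty$ on $\mathbb{R}^m\setminus\{0\}$, satisfies $\mathcal F(\lambda y)=\lambda\mathcal F(y)$ for all $\lambda>0$, and has positive-definite matrix $\left(\left[\tfrac12\mathcal F^2\right]_{y^iy^j}(y)\right)$ at all $y\ne0$. A Finsler structure on $M$ is a function $F:TM\to[0,\infty)$ that is $C^\infty$ on the slit tangent bundle $TM\setminus0$ and restricts to a Minkowski norm on each $T_xM$. A Finslerian symplectic manifold $(M,\omega,F)$ is a symplectic manifold $(M,\omega)$ together with a Finsler structure $F$ on $M$.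 Let $\pi:TM\setminus 0\to M$ be the projection. In local coordinates $(x^i)$ on $M$ with induced coordinates $(x^i,y^i)$ on $TM$, put $g_{ij}=(\tfrac12F^2)_{y^iy^j}$, $A_{ijk}=\tfrac F2\,\partial g_{ij}/\partial y^k$, and $\frac{\delta y^i}{F}=\frac1F(dy^i+N^i_j\,dx^j)$, where the nonlinear connection is $N^i_j=\tfrac12\,\partial G^i/\partial y^j$ with $G^i=\gamma^i_{jk}y^jy^k$ and $\gamma^i_{jk}=\tfrac12g^{is}\left(\partial g_{sj}/\partial x^k-\partial g_{jk}/\partial x^s+\partial g_{ks}/\partial x^j\right)$. The Chern connection $\tilde\nabla$ is the unique linear connection on the pulled-back bundle $\pi^*TM$ whose connection forms $\theta^i_j$ satisfy $dx^j\wedge\theta^i_j=0$ and $dg_{ij}-g_{kj}\theta^k_i-g_{ik}\theta^k_j=2A_{ijs}\frac{\delta y^s}{F}$. Its forms are $\theta^k_j=\tilde\Gamma^k_{ij}\,dx^i$, with Christoffel symbols $\tilde\Gamma^k_{ij}=\tilde\Gamma^k_{ij}(x,y)=\tilde\Gamma^k_{ji}(x,y)$ on $TM\setminus0$, and one writes $\tilde\nabla_{\tilde\partial_i}\tilde\partial_j=\tilde\Gamma^k_{ij}\tilde\partial_k$. Canonical lifts: for a vector field $X$ on $M$, $\tilde X$ is the section of $\pi^*TM$ with $\tilde X_{(x,y)}=X_x$ (and $\tilde\partial_i$ is the lift of $\partial_i=\partial/\partial x^i$); for the two-form $\omega$, $\tilde\omega_{(x,y)}(z_1,z_2)=\omega_x(z_1,z_2)$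 for $x\in M$, $y\in T_xM\setminus0$, $z_1,z_2\in T_xM$. The Chern connection $\tilde\nabla$ preserves $\omega$ if for all $X,Y,Z\in\mathcal X(M)$, on $TM\setminus 0$, $\tilde Z(\tilde\omega(\tilde X,\tilde Y))=\tilde\omega(\tilde\nabla_{\tilde Z}\tilde X,\tilde Y)+\tilde\omega(\tilde X,\tilde\nabla_{\tilde Z}\tilde Y)$, where $\tilde Z(\tilde\omega(\tilde X,\tilde Y)):=Z(\omega(X,Y))$. In coordinates, with $\tilde\omega_{ij}=\tilde\omega(\tilde\partial_i,\tilde\partial_j)$, this says $\tilde\partial_k\tilde\omega_{ij}=\tilde\omega_{il}\tilde\Gamma^l_{kj}-\tilde\omega_{jl}\tilde\Gamma^l_{ki}$. *)

theory Defs
  imports "HOL-Analysis.Analysis"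
begin

section \<open>Smooth maps between Euclidean spaces\<close>

text \<open>\<open>Ck_on k S f\<close>: \<open>f\<close> is of class \<open>C\<^sup>k\<close> on \<open>S\<close>.  It is only used for open \<open>S\<close>.\<close>

primrec Ck_on :: "nat \<Rightarrow> 'e::euclidean_space set \<Rightarrow> ('e \<Rightarrow> 'f::euclidean_space) \<Rightarrow> bool" where
  "Ck_on 0 S f \<longleftrightarrow> continuous_on S f"
| "Ck_on (Suc k) S f \<longleftrightarrow>
     (\<forall>x\<in>S. f differentiable (at x)) \<and> (\<forall>h. Ck_on k S (\<lambda>x. frechet_derivative f (at x) h))"

definition smooth_on :: "'e::euclidean_space set \<Rightarrow> ('e \<Rightarrow> 'f::euclidean_space) \<Rightarrow> bool" where
  "smooth_on S f \<longleftrightarrow> (\<forall>k. Ck_on k S f)"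

section \<open>Smooth manifolds\<close>

text \<open>A chart is a coordinate domain with a coordinate map, whose values outside the domain are
  irrelevant.  A manifold modelled on \<open>'e\<close> is given by an atlas; its point set is the union of the
  chart domains and its topology is the one for which all charts are homeomorphisms onto open sets.
  The atlas need not be maximal.\<close>

type_synonym ('a, 'e) chart = "'a set \<times> ('a \<Rightarrow> 'e)"

definition cdom :: "('a, 'e) chart \<Rightarrow> 'a set" where
  "cdom c = fst c"

definition cmap :: "('a, 'e) chart \<Rightarrow> 'a \<Rightarrow> 'e" where
  "cmap c = snd c"

definition cimg :: "('a, 'e) chart \<Rightarrow> 'e set" where
  "cimg c = cmap c ` cdom c"

definition cinv :: "('a, 'e) chart \<Rightarrow> 'e \<Rightarrow> 'a" where
  "cinv c = inv_into (cdom c) (cmap c)"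

definition points :: "('a, 'e) chart set \<Rightarrow> 'a set" where
  "points M = (\<Union>c\<in>M. cdom c)"

definition smooth_atlas :: "('a, 'e::euclidean_space) chart set \<Rightarrow> bool" where
  "smooth_atlas M \<longleftrightarrow>
     (\<forall>c\<in>M. inj_on (cmap c) (cdom c) \<and> open (cimg c)) \<and>
     (\<forall>c\<in>M. \<forall>c'\<in>M. open (cmap c ` (cdom c \<inter> cdom c')) \<and>
        smooth_on (cmap c ` (cdom c \<inter> cdom c')) (cmap c' \<circ> cinv c))"

definition atlas_open :: "('a, 'e::euclidean_space) chart set \<Rightarrow> 'a set \<Rightarrow> bool" where
  "atlas_open M U \<longleftrightarrow> U \<subseteq> points M \<and> (\<forall>c\<in>M. open (cmap c ` (U \<inter> cdom c)))"

definition atlas_topology :: "('a, 'e::euclidean_space) chart set \<Rightarrow> 'a topology" where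
  "atlas_topology M = topology (atlas_open M)"

lemma openin_atlas_topology:
  assumes "smooth_atlas M"
  shows "openin (atlas_topology M) U \<longleftrightarrow> atlas_open M U"
proof -
  have "istopology (atlas_open M)"
    unfolding istopology_def
  proof (intro conjI allI impI)
    fix S T assume S: "atlas_open M S" and T: "atlas_open M T"
    show "atlas_open M (S \<inter> T)"
      unfolding atlas_open_def
    proof (intro conjI ballI)
      show "S \<inter> T \<subseteq> points M" using S by (auto simp: atlas_open_def)
      fix c assume c: "c \<in> M"
      have "inj_on (cmap c) (cdom c)" using assms c by (simp add: smooth_atlas_def)
      hence "cmap c ` (S \<inter> T \<inter> cdom c) = cmap c ` (S \<inter> cdom c) \<inter> cmap c ` (T \<inter> cdom c)"
        unfolding inj_on_def by blast
      thus "open (cmap c ` (S \<inter> T \<inter> cdom c))"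
        using S T c by (simp add: atlas_open_def open_Int)
    qed
  next
    fix K assume K: "\<forall>U\<in>K. atlas_open M U"
    show "atlas_open M (\<Union>K)"
      unfolding atlas_open_def
    proof (intro conjI ballI)
      show "\<Union>K \<subseteq> points M" using K by (auto simp: atlas_open_def)
      fix c assume c: "c \<in> M"
      have "cmap c ` (\<Union>K \<inter> cdom c) = (\<Union>U\<in>K. cmap c ` (U \<inter> cdom c))" by blast
      thus "open (cmap c ` (\<Union>K \<inter> cdom c))" using K c by (auto simp: atlas_open_def)
    qed
  qed
  thus ?thesis by (simp add: atlas_topology_def topology_inverse')
qed

definition smooth_manifold :: "('a, 'e::euclidean_space) chart set \<Rightarrow> bool" where
  "smooth_manifold M \<longleftrightarrow> smooth_atlas M \<and>
     Hausdorff_space (atlas_topology M) \<and> second_countable (atlas_topology M)"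

definition smooth_fun :: "('a, 'e::euclidean_space) chart set \<Rightarrow> ('a \<Rightarrow> real) \<Rightarrow> bool" where
  "smooth_fun M \<phi> \<longleftrightarrow> (\<forall>c\<in>M. smooth_on (cimg c) (\<phi> \<circ> cinv c))"

section \<open>Tangent vectors\<close>

text \<open>A tangent vector at \<open>p\<close> assigns to every chart around \<open>p\<close> its coordinate vector, such that the
  coordinate vectors are related by the Jacobians of the coordinate changes.  The value at all
  other charts is \<open>0\<close>, so equality of tangent vectors is equality of functions.\<close>

type_synonym ('a, 'e) tvec = "('a, 'e) chart \<Rightarrow> 'e"

definition tzero :: "('a, 'e::euclidean_space) tvec" where
  "tzero = (\<lambda>c. 0)"

definition tadd :: "('a, 'e::euclidean_space) tvec \<Rightarrow> ('a, 'e) tvec \<Rightarrow> ('a, 'e) tvec" where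
  "tadd v w = (\<lambda>c. v c + w c)"

definition tscale :: "real \<Rightarrow> ('a, 'e::euclidean_space) tvec \<Rightarrow> ('a, 'e) tvec" where
  "tscale r v = (\<lambda>c. r *\<^sub>R v c)"

definition tspace :: "('a, 'e::euclidean_space) chart set \<Rightarrow> 'a \<Rightarrow> ('a, 'e) tvec set" where
  "tspace M p = {v.
     (\<forall>c\<in>M. \<forall>c'\<in>M. p \<in> cdom c \<inter> cdom c' \<longrightarrow>
        v c' = frechet_derivative (cmap c' \<circ> cinv c) (at (cmap c p)) (v c)) \<and>
     (\<forall>c. \<not> (c \<in> M \<and> p \<in> cdom c) \<longrightarrow> v c = 0)}"

text \<open>The tangent vector at \<open>p\<close> with coordinates \<open>h\<close> in the chart \<open>c\<close>, i.e.
  \<open>h\<^sup>i \<partial>\<^sub>i\<close> for the coordinate frame of \<open>c\<close>.\<close>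

definition coord_vec ::
  "('a, 'e::euclidean_space) chart set \<Rightarrow> ('a, 'e) chart \<Rightarrow> 'a \<Rightarrow> 'e \<Rightarrow> ('a, 'e) tvec" where
  "coord_vec M c p h = (\<lambda>c'. if c' \<in> M \<and> p \<in> cdom c'
     then frechet_derivative (cmap c' \<circ> cinv c) (at (cmap c p)) h else 0)"

text \<open>The derivative of a function along a tangent vector, and the differential of a map, computed
  in some chart around \<open>p\<close>; for smooth functions and maps the choice is immaterial.\<close>

definition chart_at :: "('a, 'e) chart set \<Rightarrow> 'a \<Rightarrow> ('a, 'e) chart" where
  "chart_at M p = (SOME c. c \<in> M \<and> p \<in> cdom c)"

definition dir_deriv ::
  "('a, 'e::euclidean_space) chart set \<Rightarrow> ('a \<Rightarrow> real) \<Rightarrow> 'a \<Rightarrow> ('a, 'e) tvec \<Rightarrow> real" where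
  "dir_deriv M \<phi> p u = (let c = chart_at M p in
     frechet_derivative (\<phi> \<circ> cinv c) (at (cmap c p)) (u c))"

definition differential ::
  "('b, 'f::euclidean_space) chart set \<Rightarrow> ('a, 'e::euclidean_space) chart set \<Rightarrow> ('b \<Rightarrow> 'a) \<Rightarrow>
     'b \<Rightarrow> ('b, 'f) tvec \<Rightarrow> ('a, 'e) tvec" where
  "differential B M f b \<xi> = (let d = chart_at B b in
     (\<lambda>c. if c \<in> M \<and> f b \<in> cdom c
          then frechet_derivative (cmap c \<circ> f \<circ> cinv d) (at (cmap d b)) (\<xi> d) else 0))"

section \<open>Sections and linear connections on pulled-back tangent bundles\<close>

text \<open>For a smooth map \<open>f\<close> from \<open>B\<close> to \<open>M\<close>, a section of \<open>f\<^sup>*TM\<close> assigns to \<open>b\<close> a vector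
  in \<open>T\<^bsub>f b\<^esub>M\<close>.  The identity of \<open>M\<close> gives vector fields on \<open>M\<close>, and the projection of the
  slit tangent bundle gives sections of \<open>\<pi>\<^sup>*TM\<close>.\<close>

definition smooth_section ::
  "('b, 'f::euclidean_space) chart set \<Rightarrow> ('a, 'e::euclidean_space) chart set \<Rightarrow> ('b \<Rightarrow> 'a) \<Rightarrow>
     ('b \<Rightarrow> ('a, 'e) tvec) \<Rightarrow> bool" where
  "smooth_section B M f s \<longleftrightarrow>
     (\<forall>b\<in>points B. s b \<in> tspace M (f b)) \<and>
     (\<forall>d\<in>B. \<forall>c\<in>M. smooth_on (cmap d ` {b\<in>cdom d. f b \<in> cdom c}) (\<lambda>u. s (cinv d u) c))"

abbreviation vector_field :: "('a, 'e::euclidean_space) chart set \<Rightarrow> ('a \<Rightarrow> ('a, 'e) tvec) \<Rightarrow> bool" where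
  "vector_field M \<equiv> smooth_section M M (\<lambda>p. p)"

text \<open>A linear connection on \<open>f\<^sup>*TM\<close> maps a section \<open>s\<close> to the \<open>f\<^sup>*TM\<close>-valued one-form
  \<open>\<nabla>s\<close> on \<open>B\<close>, and satisfies the Leibniz rule; \<open>D s b \<xi>\<close> is \<open>\<nabla>\<^sub>\<xi> s\<close> for \<open>\<xi> \<in> T\<^sub>b B\<close>.\<close>

type_synonym ('b, 'f, 'a, 'e) conn =
  "('b \<Rightarrow> ('a, 'e) tvec) \<Rightarrow> 'b \<Rightarrow> ('b, 'f) tvec \<Rightarrow> ('a, 'e) tvec"

definition linear_connection ::
  "('b, 'f::euclidean_space) chart set \<Rightarrow> ('a, 'e::euclidean_space) chart set \<Rightarrow> ('b \<Rightarrow> 'a) \<Rightarrow>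
     ('b, 'f, 'a, 'e) conn \<Rightarrow> bool" where
  "linear_connection B M f D \<longleftrightarrow>
     (\<forall>s. smooth_section B M f s \<longrightarrow>
        (\<forall>b\<in>points B.
           (\<forall>\<xi>\<in>tspace B b. D s b \<xi> \<in> tspace M (f b)) \<and>
           (\<forall>\<xi>\<in>tspace B b. \<forall>\<eta>\<in>tspace B b. D s b (tadd \<xi> \<eta>) = tadd (D s b \<xi>) (D s b \<eta>)) \<and>
           (\<forall>r. \<forall>\<xi>\<in>tspace B b. D s b (tscale r \<xi>) = tscale r (D s b \<xi>))) \<and>
        (\<forall>d\<in>B. \<forall>c\<in>M. \<forall>h. smooth_on (cmap d ` {b\<in>cdom d. f b \<in> cdom c})
           (\<lambda>u. D s (cinv d u) (coord_vec B d (cinv d u) h) c))) \<and>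
     (\<forall>s t. smooth_section B M f s \<and> smooth_section B M f t \<longrightarrow>
        (\<forall>b\<in>points B. \<forall>\<xi>\<in>tspace B b.
           D (\<lambda>b. tadd (s b) (t b)) b \<xi> = tadd (D s b \<xi>) (D t b \<xi>))) \<and>
     (\<forall>\<phi> s. smooth_fun B \<phi> \<and> smooth_section B M f s \<longrightarrow>
        (\<forall>b\<in>points B. \<forall>\<xi>\<in>tspace B b.
           D (\<lambda>b. tscale (\<phi> b) (s b)) b \<xi> =
             tadd (tscale (dir_deriv B \<phi> b \<xi>) (s b)) (tscale (\<phi> b) (D s b \<xi>))))"

text \<open>\<open>\<theta> u h i j\<close> is the value at \<open>h\<close> of the connection form \<open>\<theta>\<^sup>i\<^sub>j\<close> at the
  coordinate point \<open>u\<close>, with respect to the coordinates \<open>d\<close> on \<open>B\<close> and the pulled-back coordinate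
  frame of \<open>c\<close>.  The frame equation \<open>\<nabla>\<partial>\<^sub>j = \<theta>\<^sup>i\<^sub>j \<partial>\<^sub>i\<close> is stated for
  global sections \<open>s = s\<^sup>j \<partial>\<^sub>j\<close> as \<open>(\<nabla>s)\<^sup>i = ds\<^sup>i + \<theta>\<^sup>i\<^sub>j s\<^sup>j\<close>,
  since the frame itself is defined on the chart domain only.\<close>

definition connection_forms ::
  "('b, 'f::euclidean_space) chart set \<Rightarrow> ('a, real^'n) chart set \<Rightarrow> ('b \<Rightarrow> 'a) \<Rightarrow>
     ('b, 'f, 'a, real^'n) conn \<Rightarrow> ('b, 'f) chart \<Rightarrow> ('a, real^'n) chart \<Rightarrow>
     ('f \<Rightarrow> 'f \<Rightarrow> 'n \<Rightarrow> 'n \<Rightarrow> real) \<Rightarrow> bool" where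
  "connection_forms B M f D d c \<theta> \<longleftrightarrow>
     (\<forall>i j. \<forall>u \<in> cmap d ` {b\<in>cdom d. f b \<in> cdom c}. linear (\<lambda>h. \<theta> u h i j)) \<and>
     (\<forall>i j h. smooth_on (cmap d ` {b\<in>cdom d. f b \<in> cdom c}) (\<lambda>u. \<theta> u h i j)) \<and>
     (\<forall>s. smooth_section B M f s \<longrightarrow>
        (\<forall>b\<in>cdom d. f b \<in> cdom c \<longrightarrow> (\<forall>\<xi>\<in>tspace B b. \<forall>i.
           D s b \<xi> c $ i =
             frechet_derivative (\<lambda>u. s (cinv d u) c $ i) (at (cmap d b)) (\<xi> d) +
             (\<Sum>j\<in>UNIV. \<theta> (cmap d b) (\<xi> d) i j * s b c $ j))))"

section \<open>Symplectic manifolds and symplectic connections\<close>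

type_synonym ('a, 'e) form2 = "'a \<Rightarrow> ('a, 'e) tvec \<Rightarrow> ('a, 'e) tvec \<Rightarrow> real"

definition form2_rep ::
  "('a, 'e::euclidean_space) chart set \<Rightarrow> ('a, 'e) form2 \<Rightarrow> ('a, 'e) chart \<Rightarrow> 'e \<Rightarrow> 'e \<Rightarrow> 'e \<Rightarrow> real" where
  "form2_rep M \<omega> c u h k =
     \<omega> (cinv c u) (coord_vec M c (cinv c u) h) (coord_vec M c (cinv c u) k)"

definition two_form :: "('a, 'e::euclidean_space) chart set \<Rightarrow> ('a, 'e) form2 \<Rightarrow> bool" where
  "two_form M \<omega> \<longleftrightarrow>
     (\<forall>p\<in>points M. \<forall>u\<in>tspace M p. \<forall>v\<in>tspace M p.
        \<omega> p u v = - \<omega> p v u \<and>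
        (\<forall>w\<in>tspace M p. \<omega> p (tadd u v) w = \<omega> p u w + \<omega> p v w) \<and>
        (\<forall>r. \<omega> p (tscale r u) v = r * \<omega> p u v)) \<and>
     (\<forall>c\<in>M. \<forall>h k. smooth_on (cimg c) (\<lambda>u. form2_rep M \<omega> c u h k))"

text \<open>\<open>(d\<omega>)\<^bsub>ijk\<^esub> = \<partial>\<^sub>i\<omega>\<^bsub>jk\<^esub> + \<partial>\<^sub>j\<omega>\<^bsub>ki\<^esub> + \<partial>\<^sub>k\<omega>\<^bsub>ij\<^esub>\<close>\<close>

definition exterior_deriv_rep ::
  "('a, 'e::euclidean_space) chart set \<Rightarrow> ('a, 'e) form2 \<Rightarrow> ('a, 'e) chart \<Rightarrow>
     'e \<Rightarrow> 'e \<Rightarrow> 'e \<Rightarrow> 'e \<Rightarrow> real" where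
  "exterior_deriv_rep M \<omega> c u h k l =
     frechet_derivative (\<lambda>u. form2_rep M \<omega> c u k l) (at u) h +
     frechet_derivative (\<lambda>u. form2_rep M \<omega> c u l h) (at u) k +
     frechet_derivative (\<lambda>u. form2_rep M \<omega> c u h k) (at u) l"

definition closed_form2 :: "('a, 'e::euclidean_space) chart set \<Rightarrow> ('a, 'e) form2 \<Rightarrow> bool" where
  "closed_form2 M \<omega> \<longleftrightarrow>
     (\<forall>c\<in>M. \<forall>u\<in>cimg c. \<forall>h k l. exterior_deriv_rep M \<omega> c u h k l = 0)"

definition nondegenerate_form2 :: "('a, 'e::euclidean_space) chart set \<Rightarrow> ('a, 'e) form2 \<Rightarrow> bool" where
  "nondegenerate_form2 M \<omega> \<longleftrightarrow>
     (\<forall>p\<in>points M. \<forall>u\<in>tspace M p. (\<forall>v\<in>tspace M p. \<omega> p u v = 0) \<longrightarrow> u = tzero)"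

definition symplectic_manifold :: "('a, 'e::euclidean_space) chart set \<Rightarrow> ('a, 'e) form2 \<Rightarrow> bool" where
  "symplectic_manifold M \<omega> \<longleftrightarrow> smooth_manifold M \<and>
     two_form M \<omega> \<and> nondegenerate_form2 M \<omega> \<and> closed_form2 M \<omega>"

text \<open>\<open>[X, Y]\<^sup>i = X\<^sup>j \<partial>\<^sub>jY\<^sup>i - Y\<^sup>j \<partial>\<^sub>jX\<^sup>i\<close> in every chart.\<close>

definition lie_bracket ::
  "('a, 'e::euclidean_space) chart set \<Rightarrow> ('a \<Rightarrow> ('a, 'e) tvec) \<Rightarrow> ('a \<Rightarrow> ('a, 'e) tvec) \<Rightarrow>
     'a \<Rightarrow> ('a, 'e) tvec" where
  "lie_bracket M X Y p = (\<lambda>c. if c \<in> M \<and> p \<in> cdom c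
     then frechet_derivative (\<lambda>u. Y (cinv c u) c) (at (cmap c p)) (X p c) -
          frechet_derivative (\<lambda>u. X (cinv c u) c) (at (cmap c p)) (Y p c)
     else 0)"

type_synonym ('a, 'e) affine_conn = "('a, 'e, 'a, 'e) conn"

definition torsion_free ::
  "('a, 'e::euclidean_space) chart set \<Rightarrow> ('a, 'e) affine_conn \<Rightarrow> bool" where
  "torsion_free M D \<longleftrightarrow>
     (\<forall>X Y. vector_field M X \<and> vector_field M Y \<longrightarrow>
        (\<forall>p\<in>points M. D Y p (X p) = tadd (D X p (Y p)) (lie_bracket M X Y p)))"

definition preserves_form2 ::
  "('a, 'e::euclidean_space) chart set \<Rightarrow> ('a, 'e) form2 \<Rightarrow> ('a, 'e) affine_conn \<Rightarrow> bool" where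
  "preserves_form2 M \<omega> D \<longleftrightarrow>
     (\<forall>X Y Z. vector_field M X \<and> vector_field M Y \<and> vector_field M Z \<longrightarrow>
        (\<forall>p\<in>points M. dir_deriv M (\<lambda>q. \<omega> q (X q) (Y q)) p (Z p) =
           \<omega> p (D X p (Z p)) (Y p) + \<omega> p (X p) (D Y p (Z p))))"

definition symplectic_connection ::
  "('a, 'e::euclidean_space) chart set \<Rightarrow> ('a, 'e) form2 \<Rightarrow> ('a, 'e) affine_conn \<Rightarrow> bool" where
  "symplectic_connection M \<omega> D \<longleftrightarrow>
     linear_connection M M (\<lambda>p. p) D \<and> torsion_free M D \<and> preserves_form2 M \<omega> D"

definition fedosov_manifold ::
  "('a, 'e::euclidean_space) chart set \<Rightarrow> ('a, 'e) form2 \<Rightarrow> ('a, 'e) affine_conn \<Rightarrow> bool" where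
  "fedosov_manifold M \<omega> D \<longleftrightarrow> symplectic_manifold M \<omega> \<and> symplectic_connection M \<omega> D"

section \<open>Finsler structures\<close>

definition minkowski_norm :: "(real^'n \<Rightarrow> real) \<Rightarrow> bool" where
  "minkowski_norm F \<longleftrightarrow>
     (\<forall>y. 0 \<le> F y) \<and> smooth_on (- {0}) F \<and>
     (\<forall>r>0. \<forall>y. F (r *\<^sub>R y) = r * F y) \<and>
     (\<forall>y. y \<noteq> 0 \<longrightarrow> (\<forall>z. z \<noteq> 0 \<longrightarrow>
        0 < (\<Sum>i\<in>UNIV. \<Sum>j\<in>UNIV.
               frechet_derivative
                 (\<lambda>y. frechet_derivative (\<lambda>y. (F y)\<^sup>2 / 2) (at y) (axis i 1)) (at y) (axis j 1)
               * z $ i * z $ j)))"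

text \<open>The points of the slit tangent bundle are the pairs \<open>(p, v)\<close> with \<open>v \<in> T\<^sub>pM\<close> nonzero; a
  chart \<open>(x\<^sup>i)\<close> of \<open>M\<close> induces the chart \<open>(x\<^sup>i, y\<^sup>i)\<close>.\<close>

definition slit_chart ::
  "('a, 'e::euclidean_space) chart set \<Rightarrow> ('a, 'e) chart \<Rightarrow> ('a \<times> ('a, 'e) tvec, 'e \<times> 'e) chart" where
  "slit_chart M c =
     ({(p, v). p \<in> cdom c \<and> v \<in> tspace M p \<and> v \<noteq> tzero}, \<lambda>(p, v). (cmap c p, v c))"

definition slit_tangent ::
  "('a, 'e::euclidean_space) chart set \<Rightarrow> ('a \<times> ('a, 'e) tvec, 'e \<times> 'e) chart set" where
  "slit_tangent M = slit_chart M ` M"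

text \<open>A Finsler structure is defined on all of \<open>TM\<close>, the zero section included; values at pairs
  \<open>(p, v)\<close> with \<open>v \<notin> T\<^sub>pM\<close> are irrelevant.  Each \<open>T\<^sub>pM\<close> is identified with
  \<open>\<real>\<^sup>m\<close> through the charts around \<open>p\<close>.\<close>

definition finsler_structure ::
  "('a, real^'n) chart set \<Rightarrow> ('a \<times> ('a, real^'n) tvec \<Rightarrow> real) \<Rightarrow> bool" where
  "finsler_structure M F \<longleftrightarrow>
     smooth_fun (slit_tangent M) F \<and>
     (\<forall>c\<in>M. \<forall>p\<in>cdom c. minkowski_norm (\<lambda>y. F (p, coord_vec M c p y)))"

definition finslerian_symplectic_manifold ::
  "('a, real^'n) chart set \<Rightarrow> ('a, real^'n) form2 \<Rightarrow> ('a \<times> ('a, real^'n) tvec \<Rightarrow> real) \<Rightarrow> bool" where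
  "finslerian_symplectic_manifold M \<omega> F \<longleftrightarrow> symplectic_manifold M \<omega> \<and> finsler_structure M F"

definition finsler_rep ::
  "('a, real^'n) chart set \<Rightarrow> ('a \<times> ('a, real^'n) tvec \<Rightarrow> real) \<Rightarrow> ('a, real^'n) chart \<Rightarrow>
     (real^'n) \<times> (real^'n) \<Rightarrow> real" where
  "finsler_rep M F c = (\<lambda>(x, y). F (cinv c x, coord_vec M c (cinv c x) y))"

section \<open>The Chern connection\<close>

text \<open>In this group of definitions \<open>L\<close> is the coordinate expression of the Finsler structure as a
  function of \<open>z = (x, y)\<close>.\<close>

definition dx :: "'n \<Rightarrow> ((real^'n) \<times> (real^'n) \<Rightarrow> real) \<Rightarrow> (real^'n) \<times> (real^'n) \<Rightarrow> real" where
  "dx k f z = frechet_derivative f (at z) (axis k 1, 0)"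

definition dy :: "'n \<Rightarrow> ((real^'n) \<times> (real^'n) \<Rightarrow> real) \<Rightarrow> (real^'n) \<times> (real^'n) \<Rightarrow> real" where
  "dy k f z = frechet_derivative f (at z) (0, axis k 1)"

definition fund :: "((real^'n) \<times> (real^'n) \<Rightarrow> real) \<Rightarrow> 'n \<Rightarrow> 'n \<Rightarrow> (real^'n) \<times> (real^'n) \<Rightarrow> real" where
  "fund L i j = dy j (dy i (\<lambda>z. (L z)\<^sup>2 / 2))"

definition fund_inv :: "((real^'n) \<times> (real^'n) \<Rightarrow> real) \<Rightarrow> 'n \<Rightarrow> 'n \<Rightarrow> (real^'n) \<times> (real^'n) \<Rightarrow> real" where
  "fund_inv L i j z = matrix_inv (\<chi> i j. fund L i j z) $ i $ j"

definition cartan ::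
  "((real^'n) \<times> (real^'n) \<Rightarrow> real) \<Rightarrow> 'n \<Rightarrow> 'n \<Rightarrow> 'n \<Rightarrow> (real^'n) \<times> (real^'n) \<Rightarrow> real" where
  "cartan L i j k z = L z / 2 * dy k (fund L i j) z"

definition formal_christoffel ::
  "((real^'n) \<times> (real^'n) \<Rightarrow> real) \<Rightarrow> 'n \<Rightarrow> 'n \<Rightarrow> 'n \<Rightarrow> (real^'n) \<times> (real^'n) \<Rightarrow> real" where
  "formal_christoffel L i j k z =
     (\<Sum>s\<in>UNIV. fund_inv L i s z *
        (dx k (fund L s j) z - dx s (fund L j k) z + dx j (fund L k s) z)) / 2"

definition spray :: "((real^'n) \<times> (real^'n) \<Rightarrow> real) \<Rightarrow> 'n \<Rightarrow> (real^'n) \<times> (real^'n) \<Rightarrow> real" where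
  "spray L i z = (\<Sum>j\<in>UNIV. \<Sum>k\<in>UNIV. formal_christoffel L i j k z * snd z $ j * snd z $ k)"

definition nonlin_conn ::
  "((real^'n) \<times> (real^'n) \<Rightarrow> real) \<Rightarrow> 'n \<Rightarrow> 'n \<Rightarrow> (real^'n) \<times> (real^'n) \<Rightarrow> real" where
  "nonlin_conn L i j z = dy j (spray L i) z / 2"

text \<open>The one-form \<open>\<delta>y\<^sup>i / F\<close> at \<open>z\<close>, evaluated at \<open>h\<close>.\<close>

definition delta_y ::
  "((real^'n) \<times> (real^'n) \<Rightarrow> real) \<Rightarrow> 'n \<Rightarrow> (real^'n) \<times> (real^'n) \<Rightarrow> (real^'n) \<times> (real^'n) \<Rightarrow> real" where
  "delta_y L i z h = (snd h $ i + (\<Sum>j\<in>UNIV. nonlin_conn L i j z * fst h $ j)) / L z"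

text \<open>The two structure equations: \<open>dx\<^sup>j \<and> \<theta>\<^sup>i\<^sub>j = 0\<close>, evaluated at pairs of vectors, and
  \<open>dg\<^bsub>ij\<^esub> - g\<^bsub>kj\<^esub>\<theta>\<^sup>k\<^sub>i - g\<^bsub>ik\<^esub>\<theta>\<^sup>k\<^sub>j = 2 A\<^bsub>ijs\<^esub> \<delta>y\<^sup>s / F\<close>.\<close>

definition chern_torsion_free ::
  "((real^'n) \<times> (real^'n)) set \<Rightarrow>
     ((real^'n) \<times> (real^'n) \<Rightarrow> (real^'n) \<times> (real^'n) \<Rightarrow> 'n \<Rightarrow> 'n \<Rightarrow> real) \<Rightarrow> bool" where
  "chern_torsion_free S \<theta> \<longleftrightarrow>
     (\<forall>z\<in>S. \<forall>h k i. (\<Sum>j\<in>UNIV. fst h $ j * \<theta> z k i j - fst k $ j * \<theta> z h i j) = 0)"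

definition chern_almost_metric ::
  "((real^'n) \<times> (real^'n) \<Rightarrow> real) \<Rightarrow> ((real^'n) \<times> (real^'n)) set \<Rightarrow>
     ((real^'n) \<times> (real^'n) \<Rightarrow> (real^'n) \<times> (real^'n) \<Rightarrow> 'n \<Rightarrow> 'n \<Rightarrow> real) \<Rightarrow> bool" where
  "chern_almost_metric L S \<theta> \<longleftrightarrow>
     (\<forall>z\<in>S. \<forall>h i j.
        frechet_derivative (fund L i j) (at z) h
          - (\<Sum>k\<in>UNIV. fund L k j z * \<theta> z h k i) - (\<Sum>k\<in>UNIV. fund L i k z * \<theta> z h k j)
        = 2 * (\<Sum>s\<in>UNIV. cartan L i j s z * delta_y L s z h))"

definition chern_connection ::
  "('a, real^'n) chart set \<Rightarrow> ('a \<times> ('a, real^'n) tvec \<Rightarrow> real) \<Rightarrow>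
     ('a \<times> ('a, real^'n) tvec, (real^'n) \<times> (real^'n), 'a, real^'n) conn \<Rightarrow> bool" where
  "chern_connection M F D \<longleftrightarrow>
     linear_connection (slit_tangent M) M fst D \<and>
     (\<forall>c\<in>M. \<exists>\<theta>. connection_forms (slit_tangent M) M fst D (slit_chart M c) c \<theta> \<and>
        chern_torsion_free (cimg (slit_chart M c)) \<theta> \<and>
        chern_almost_metric (finsler_rep M F c) (cimg (slit_chart M c)) \<theta>)"

definition lift_field :: "('a \<Rightarrow> ('a, 'e) tvec) \<Rightarrow> 'a \<times> ('a, 'e) tvec \<Rightarrow> ('a, 'e) tvec" where
  "lift_field X = (\<lambda>(p, v). X p)"

text \<open>Since the forms of the Chern connection contain no \<open>dy\<close>-part, \<open>D (lift_field X) b \<xi>\<close>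
  depends on \<open>\<xi>\<close> only through its projection to \<open>M\<close>.  The derivative along the lift of \<open>Z\<close> is
  therefore the one along any \<open>\<xi>\<close> at \<open>b = (p, v)\<close> that projects to \<open>Z p\<close>.\<close>

definition chern_preserves_form2 ::
  "('a, 'e::euclidean_space) chart set \<Rightarrow> ('a, 'e) form2 \<Rightarrow>
     ('a \<times> ('a, 'e) tvec, 'e \<times> 'e, 'a, 'e) conn \<Rightarrow> bool" where
  "chern_preserves_form2 M \<omega> D \<longleftrightarrow>
     (\<forall>X Y Z. vector_field M X \<and> vector_field M Y \<and> vector_field M Z \<longrightarrow>
        (\<forall>(p, v)\<in>points (slit_tangent M). \<forall>\<xi>\<in>tspace (slit_tangent M) (p, v).
           differential (slit_tangent M) M fst (p, v) \<xi> = Z p \<longrightarrow>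
           dir_deriv M (\<lambda>q. \<omega> q (X q) (Y q)) p (Z p) =
             \<omega> p (D (lift_field X) (p, v) \<xi>) (Y p) + \<omega> p (X p) (D (lift_field Y) (p, v) \<xi>)))"

end

theory Submission
  imports Defs
begin

text \<open>The Chern connection differentiates sections of \<open>\<pi>\<^sup>*TM\<close>, with Christoffel symbols
  \<open>\<Gamma>\<^sup>k\<^sub>i\<^sub>j(x, y)\<close> that depend on a nonzero tangent vector \<open>y\<close>.  The nowhere vanishing field
  \<open>W\<close> supplies such a vector at every point, and \<open>\<Gamma>\<^sup>k\<^sub>i\<^sub>j(x, W(x))\<close> are the Christoffel symbols of
  a linear connection on \<open>M\<close>.  It inherits symmetry in \<open>i, j\<close> and, pointwise in \<open>y\<close>, the
  compatibility with \<open>\<omega>\<close>, so it is a symplectic connection.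

  Without coordinates, this connection is
  \<open>\<nabla>\<^sub>v X = D\<^sub>\<xi> (lift_field X)\<close> at \<open>(p, W p)\<close>, where \<open>\<xi>\<close> is any vector tangent to the slit tangent bundle
  that projects to \<open>v\<close>; it is called \<open>restrict_along M D W\<close> below.  The choice of \<open>\<xi>\<close> is immaterial because
  the connection forms vanish on vertical vectors (\<open>slit_connection_projection\<close>), a consequence of
  the torsion equation.  In this form additivity, the Leibniz rule and the preservation of \<open>\<omega>\<close>
  are those of \<open>D\<close>; linearity in \<open>v\<close> comes from the freedom in \<open>\<xi>\<close>.  Smoothness follows by pulling back the
  smoothness of \<open>D\<close> along the section \<open>x \<mapsto> (x, W(x))\<close> of the slit tangent bundle, and
  torsion-freeness is the symmetry of the forms in the local formula
  \<open>slit_connection_local\<close>.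

  What remains is the calculus of smooth maps between Euclidean spaces, chiefly
  the chain rule \<open>Ck_on_compose\<close>, and the fact that the induced charts form a smooth atlas of the slit tangent
  bundle (\<open>smooth_atlas_slit_tangent\<close>), whose coordinate changes are the tangent maps of those
  of \<open>M\<close>.\<close>

section \<open>Calculus of smooth maps\<close>

lemma Ck_on_cong:
  assumes "open S" and "\<And>x. x \<in> S \<Longrightarrow> f x = g x" and "Ck_on k S f"
  shows "Ck_on k S g"
  using assms(2,3)
proof (induction k arbitrary: f g)
  case 0
  then show ?case using continuous_on_cong[of S S f g] by simp
next
  case (Suc k)
  have diff: "f differentiable (at x)" if "x \<in> S" for x
    using Suc.prems(2) that by simp
  have "g differentiable (at x)" if "x \<in> S" for x
    using diff[OF that] has_derivative_transform_within_open[OF _ assms(1) that Suc.prems(1)]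
    unfolding differentiable_def by meson
  moreover have "Ck_on k S (\<lambda>x. frechet_derivative g (at x) h)" for h
  proof (rule Suc.IH)
    show "Ck_on k S (\<lambda>x. frechet_derivative f (at x) h)" using Suc.prems(2) by simp
    show "frechet_derivative f (at x) h = frechet_derivative g (at x) h" if "x \<in> S" for x
      using frechet_derivative_transform_within_open[OF diff[OF that] assms(1) that Suc.prems(1)]
      by simp
  qed
  ultimately show ?case by simp
qed

lemma Ck_on_SucI:
  assumes "open S" and der: "\<And>x. x \<in> S \<Longrightarrow> (f has_derivative D x) (at x)"
    and "\<And>h. Ck_on k S (\<lambda>x. D x h)"
  shows "Ck_on (Suc k) S f"
proof -
  have "Ck_on k S (\<lambda>x. frechet_derivative f (at x) h)" for h
  proof (rule Ck_on_cong[OF assms(1) _ assms(3)])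
    show "D x h = frechet_derivative f (at x) h" if "x \<in> S" for x
      using frechet_derivative_at[OF der[OF that]] by simp
  qed
  moreover have "f differentiable (at x)" if "x \<in> S" for x
    using der[OF that] unfolding differentiable_def by blast
  ultimately show ?thesis by simp
qed

lemma Ck_on_subset: "Ck_on k S f \<Longrightarrow> T \<subseteq> S \<Longrightarrow> Ck_on k T f"
  by (induction k arbitrary: f) (auto intro: continuous_on_subset)

lemma continuous_on_if_differentiable_at:
  "\<forall>x\<in>S. f differentiable (at x) \<Longrightarrow> continuous_on S f"
  by (meson continuous_at_imp_continuous_on differentiable_imp_continuous_within)

lemma Ck_on_SucD: "Ck_on (Suc k) S f \<Longrightarrow> Ck_on k S f"
proof (induction k arbitrary: f)
  case 0
  then show ?case by (simp add: continuous_on_if_differentiable_at)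
next
  case (Suc k)
  then show ?case by (metis Ck_on.simps(2))
qed

lemma Ck_on_const: "Ck_on k S (\<lambda>x. a)"
  by (induction k arbitrary: a) simp_all

lemma Ck_on_linear:
  assumes "bounded_linear f"
  shows "Ck_on k S f"
proof (cases k)
  case 0
  then show ?thesis using assms by (simp add: linear_continuous_on)
next
  case (Suc k)
  have "(f has_derivative f) (at x)" for x
    using assms by (rule bounded_linear_imp_has_derivative)
  hence "frechet_derivative f (at x) = f" "f differentiable (at x)" for x
    by (metis frechet_derivative_at, metis differentiable_def)
  then show ?thesis using Suc by (simp add: Ck_on_const)
qed

lemma Ck_on_add:
  assumes "Ck_on k S f" and "Ck_on k S g" and "open S"
  shows "Ck_on k S (\<lambda>x. f x + g x)"
  using assms(1,2)
proof (induction k arbitrary: f g)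
  case 0
  then show ?case by (simp add: continuous_on_add)
next
  case (Suc k)
  show ?case
  proof (rule Ck_on_SucI[OF assms(3)])
    show "((\<lambda>x. f x + g x) has_derivative
        (\<lambda>h. frechet_derivative f (at x) h + frechet_derivative g (at x) h)) (at x)"
      if "x \<in> S" for x
      using Suc.prems that by (intro has_derivative_add) (simp_all add: frechet_derivative_works)
    show "Ck_on k S (\<lambda>x. frechet_derivative f (at x) h + frechet_derivative g (at x) h)" for h
      using Suc by simp
  qed
qed

lemma Ck_on_sum:
  assumes "finite I" and "\<And>i. i \<in> I \<Longrightarrow> Ck_on k S (f i)" and "open S"
  shows "Ck_on k S (\<lambda>x. \<Sum>i\<in>I. f i x)"
  using assms(1,2) by (induction I) (auto intro: Ck_on_const Ck_on_add assms(3))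

lemma Ck_on_bilinear:
  fixes b :: "'f::euclidean_space \<Rightarrow> 'g::euclidean_space \<Rightarrow> 'h::euclidean_space"
  assumes b: "bounded_bilinear b" and "Ck_on k S f" and "Ck_on k S g" and "open S"
  shows "Ck_on k S (\<lambda>x. b (f x) (g x))"
  using assms(2,3)
proof (induction k arbitrary: f g)
  case 0
  then show ?case by (simp add: bounded_bilinear.continuous_on[OF b])
next
  case (Suc k)
  let ?D = "\<lambda>x h. b (f x) (frechet_derivative g (at x) h) + b (frechet_derivative f (at x) h) (g x)"
  have der: "((\<lambda>x. b (f x) (g x)) has_derivative ?D x) (at x)" if "x \<in> S" for x
    using Suc.prems that by (intro bounded_bilinear.FDERIV[OF b]) (auto simp: frechet_derivative_works)
  have "Ck_on k S (\<lambda>x. ?D x h)" for h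
    using Suc.prems
    by (intro Ck_on_add assms(4) Suc.IH) (simp_all add: Ck_on_SucD del: Ck_on.simps(2), simp_all)
  with der show ?case by (rule Ck_on_SucI[OF assms(4)])
qed

lemma linear_eq_sum_Basis:
  fixes f :: "'e::euclidean_space \<Rightarrow> 'f::real_vector"
  assumes "linear f"
  shows "f v = (\<Sum>b\<in>Basis. (v \<bullet> b) *\<^sub>R f b)"
proof -
  have "f v = f (\<Sum>b\<in>Basis. (v \<bullet> b) *\<^sub>R b)" by (simp add: euclidean_representation)
  also have "\<dots> = (\<Sum>b\<in>Basis. (v \<bullet> b) *\<^sub>R f b)"
    using assms by (simp add: linear_sum linear_scale)
  finally show ?thesis .
qed

text \<open>Class \<open>C\<^sup>k\<close> speaks of directional derivatives with a fixed direction, whereas the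
  chain rule produces the derivative of \<open>g\<close> in the varying direction \<open>Df(x) h\<close>.  Expanding that
  direction in a basis turns the derivative of the composition into a sum of products, to which
  the induction hypothesis applies.\<close>

lemma Ck_on_compose:
  fixes f :: "'e::euclidean_space \<Rightarrow> 'f::euclidean_space"
    and g :: "'f \<Rightarrow> 'g::euclidean_space"
  assumes "Ck_on k S f" and "Ck_on k T g" and "f ` S \<subseteq> T" and "open S"
  shows "Ck_on k S (\<lambda>x. g (f x))"
  using assms(1,2)
proof (induction k arbitrary: g)
  case 0
  then show ?case
    unfolding Ck_on.simps by (metis assms(3) continuous_on_compose2)
next
  case (Suc k)
  let ?D = "\<lambda>x h. \<Sum>b\<in>Basis. (frechet_derivative f (at x) h \<bullet> b) *\<^sub>R frechet_derivative g (at (f x)) b"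
  have der: "((\<lambda>x. g (f x)) has_derivative ?D x) (at x)" if "x \<in> S" for x
  proof -
    have f: "f differentiable (at x)" and g: "g differentiable (at (f x))"
      using Suc.prems that assms(3) by auto
    have "((\<lambda>x. g (f x)) has_derivative
        (\<lambda>h. frechet_derivative g (at (f x)) (frechet_derivative f (at x) h))) (at x)"
      using diff_chain_at[of f "frechet_derivative f (at x)" x g] f g
      by (simp add: frechet_derivative_works o_def)
    moreover have "(\<lambda>h. frechet_derivative g (at (f x)) (frechet_derivative f (at x) h)) = ?D x"
      by (rule ext) (rule linear_eq_sum_Basis[OF linear_frechet_derivative[OF g]])
    ultimately show ?thesis by (rule has_derivative_eq_rhs)
  qed
  have "Ck_on k S (\<lambda>x. ?D x h)" for h
  proof (intro Ck_on_sum Ck_on_bilinear[OF bounded_bilinear_scaleR] assms(4))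
    fix b :: 'f
    show "Ck_on k S (\<lambda>x. frechet_derivative f (at x) h \<bullet> b)"
      using Suc.prems by (intro Ck_on_bilinear[OF bounded_bilinear_inner] Ck_on_const assms(4)) simp
    show "Ck_on k S (\<lambda>x. frechet_derivative g (at (f x)) b)"
      using Suc.prems(2) by (intro Suc.IH Ck_on_SucD[OF Suc.prems(1)]) simp
  qed simp
  with der show ?case by (rule Ck_on_SucI[OF assms(4)])
qed

lemma smooth_on_cong:
  "open S \<Longrightarrow> (\<And>x. x \<in> S \<Longrightarrow> f x = g x) \<Longrightarrow> smooth_on S f \<Longrightarrow> smooth_on S g"
  unfolding smooth_on_def by (metis Ck_on_cong)

lemma smooth_on_linear: "bounded_linear f \<Longrightarrow> smooth_on S f"
  by (simp add: smooth_on_def Ck_on_linear)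

lemma smooth_on_subset: "smooth_on S f \<Longrightarrow> T \<subseteq> S \<Longrightarrow> smooth_on T f"
  unfolding smooth_on_def by (metis Ck_on_subset)

lemma smooth_on_compose:
  "smooth_on S f \<Longrightarrow> smooth_on T g \<Longrightarrow> f ` S \<subseteq> T \<Longrightarrow> open S \<Longrightarrow> smooth_on S (\<lambda>x. g (f x))"
  unfolding smooth_on_def by (metis Ck_on_compose)

lemma smooth_on_differentiable: "smooth_on S f \<Longrightarrow> x \<in> S \<Longrightarrow> f differentiable (at x)"
  unfolding smooth_on_def by (metis Ck_on.simps(2))

lemma smooth_on_frechet_derivative:
  "smooth_on S f \<Longrightarrow> smooth_on S (\<lambda>x. frechet_derivative f (at x) h)"
  unfolding smooth_on_def by (metis Ck_on.simps(2))

lemma smooth_on_add: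
  "smooth_on S f \<Longrightarrow> smooth_on S g \<Longrightarrow> open S \<Longrightarrow> smooth_on S (\<lambda>x. f x + g x)"
  by (simp add: smooth_on_def Ck_on_add)

lemma smooth_on_scaleR:
  "smooth_on S f \<Longrightarrow> smooth_on S g \<Longrightarrow> open S \<Longrightarrow> smooth_on S (\<lambda>x. f x *\<^sub>R g x)"
  by (simp add: smooth_on_def Ck_on_bilinear[OF bounded_bilinear_scaleR])

lemma smooth_on_Pair:
  assumes "smooth_on S f" and "smooth_on S g" and "open S"
  shows "smooth_on S (\<lambda>x. (f x, g x))"
proof -
  have "smooth_on S (\<lambda>x. (f x, 0) + (0, g x))"
    by (intro smooth_on_add smooth_on_compose[OF assms(1) smooth_on_linear[of _ UNIV]]
        smooth_on_compose[OF assms(2) smooth_on_linear[of _ UNIV]] assms(3)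
        bounded_linear_Pair bounded_linear_ident bounded_linear_zero) simp_all
  then show ?thesis by simp
qed

lemma smooth_on_fst:
  assumes "open S" and "open T" and "smooth_on S f"
  shows "smooth_on (S \<times> T) (\<lambda>z. f (fst z))"
proof (rule smooth_on_compose[OF smooth_on_linear[OF bounded_linear_fst] assms(3)])
  show "fst ` (S \<times> T) \<subseteq> S" by auto
  show "open (S \<times> T)" using assms(1,2) by (rule open_Times)
qed

text \<open>The tangent map of \<open>f\<close>: again the second component has a varying direction, which is
  expanded in a basis.\<close>

lemma smooth_on_tangent_map:
  fixes f :: "'e::euclidean_space \<Rightarrow> 'f::euclidean_space"
  assumes f: "smooth_on S f" and S: "open S" and T: "open T"
  shows "smooth_on (S \<times> T) (\<lambda>(x, y). (f x, frechet_derivative f (at x) y))"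
proof -
  have ST: "open (S \<times> T)" using S T by (rule open_Times)
  have "smooth_on (S \<times> T) (\<lambda>z. \<Sum>b\<in>Basis. (snd z \<bullet> b) *\<^sub>R frechet_derivative f (at (fst z)) b)"
    unfolding smooth_on_def
  proof (intro allI Ck_on_sum ST finite_Basis)
    fix k and b :: 'e
    have "smooth_on (S \<times> T) (\<lambda>z. (snd z \<bullet> b) *\<^sub>R frechet_derivative f (at (fst z)) b)"
      by (intro smooth_on_scaleR ST smooth_on_fst[OF S T, of "\<lambda>x. frechet_derivative f (at x) b"]
          smooth_on_frechet_derivative f smooth_on_linear
          bounded_linear_compose[OF bounded_linear_inner_left bounded_linear_snd])
    then show "Ck_on k (S \<times> T) (\<lambda>z. (snd z \<bullet> b) *\<^sub>R frechet_derivative f (at (fst z)) b)"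
      by (simp add: smooth_on_def)
  qed
  moreover have "(\<Sum>b\<in>Basis. (snd z \<bullet> b) *\<^sub>R frechet_derivative f (at (fst z)) b) =
      frechet_derivative f (at (fst z)) (snd z)" if "z \<in> S \<times> T" for z
    using that linear_eq_sum_Basis[OF linear_frechet_derivative[OF smooth_on_differentiable[OF f]]]
    by (metis mem_Times_iff)
  ultimately have "smooth_on (S \<times> T) (\<lambda>z. frechet_derivative f (at (fst z)) (snd z))"
    by (rule smooth_on_cong[OF ST, rotated])
  then show ?thesis
    using smooth_on_Pair[OF smooth_on_fst[OF S T f] _ ST] by (simp add: case_prod_unfold)
qed

section \<open>Tangent vectors of a smooth atlas\<close>

lemma cinv_cmap: "smooth_atlas M \<Longrightarrow> c \<in> M \<Longrightarrow> p \<in> cdom c \<Longrightarrow> cinv c (cmap c p) = p"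
  unfolding cinv_def smooth_atlas_def by simp

lemma cmap_cinv: "x \<in> cimg c \<Longrightarrow> cmap c (cinv c x) = x" "x \<in> cimg c \<Longrightarrow> cinv c x \<in> cdom c"
  unfolding cinv_def cimg_def by (simp_all add: f_inv_into_f inv_into_into)

lemma open_cimg: "smooth_atlas M \<Longrightarrow> c \<in> M \<Longrightarrow> open (cimg c)"
  unfolding smooth_atlas_def by blast

lemma cmap_in_cimg: "p \<in> cdom c \<Longrightarrow> cmap c p \<in> cimg c"
  unfolding cimg_def by blast

lemma open_overlap:
  "smooth_atlas M \<Longrightarrow> c \<in> M \<Longrightarrow> c' \<in> M \<Longrightarrow> open (cmap c ` (cdom c \<inter> cdom c'))"
  unfolding smooth_atlas_def by blast

lemma smooth_on_transition:
  "smooth_atlas M \<Longrightarrow> c \<in> M \<Longrightarrow> c' \<in> M \<Longrightarrow>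
    smooth_on (cmap c ` (cdom c \<inter> cdom c')) (cmap c' \<circ> cinv c)"
  unfolding smooth_atlas_def by blast

lemma transition_differentiable:
  assumes "smooth_atlas M" "c \<in> M" "c' \<in> M" "p \<in> cdom c" "p \<in> cdom c'"
  shows "(cmap c' \<circ> cinv c) differentiable (at (cmap c p))"
  using smooth_on_differentiable[OF smooth_on_transition[OF assms(1-3)]] assms(4,5) by blast

text \<open>The chain rule behind all independence of charts; with \<open>f = cmap c''\<close> it is the cocycle property of
  the Jacobians.\<close>

lemma frechet_derivative_change_chart:
  assumes M: "smooth_atlas M" "c \<in> M" "c' \<in> M" and p: "p \<in> cdom c" "p \<in> cdom c'"
    and f: "(f \<circ> cinv c') differentiable (at (cmap c' p))"
  shows "frechet_derivative (f \<circ> cinv c) (at (cmap c p)) h =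
    frechet_derivative (f \<circ> cinv c') (at (cmap c' p))
      (frechet_derivative (cmap c' \<circ> cinv c) (at (cmap c p)) h)"
proof -
  let ?g = "(f \<circ> cinv c') \<circ> (cmap c' \<circ> cinv c)"
  have \<tau>: "(cmap c' \<circ> cinv c) differentiable (at (cmap c p))"
    using M p by (rule transition_differentiable)
  have val: "(cmap c' \<circ> cinv c) (cmap c p) = cmap c' p"
    using M p by (simp add: cinv_cmap)
  have f': "(f \<circ> cinv c') differentiable (at ((cmap c' \<circ> cinv c) (cmap c p)))"
    unfolding val by (rule f)
  have "frechet_derivative (f \<circ> cinv c) (at (cmap c p)) = frechet_derivative ?g (at (cmap c p))"
  proof (rule frechet_derivative_transform_within_open[symmetric])
    show "?g differentiable (at (cmap c p))"
      using \<tau> f' by (rule differentiable_chain_at)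
    show "open (cmap c ` (cdom c \<inter> cdom c'))" using M by (rule open_overlap)
    show "cmap c p \<in> cmap c ` (cdom c \<inter> cdom c')" using p by blast
    show "?g x = (f \<circ> cinv c) x" if "x \<in> cmap c ` (cdom c \<inter> cdom c')" for x
      using that M by (auto simp: cinv_cmap)
  qed
  also have "\<dots> = frechet_derivative (f \<circ> cinv c') (at (cmap c' p)) \<circ>
      frechet_derivative (cmap c' \<circ> cinv c) (at (cmap c p))"
    using frechet_derivative_compose[OF \<tau> f'] unfolding val .
  finally show ?thesis by simp
qed

lemma frechet_derivative_transition_self:
  assumes "smooth_atlas M" "c \<in> M" "p \<in> cdom c"
  shows "frechet_derivative (cmap c \<circ> cinv c) (at (cmap c p)) h = h"
proof -
  have "frechet_derivative (\<lambda>x. x) (at (cmap c p)) =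
      frechet_derivative (cmap c \<circ> cinv c) (at (cmap c p))"
    by (rule frechet_derivative_transform_within_open[OF _ open_cimg[OF assms(1,2)]])
      (auto simp: cmap_cinv cmap_in_cimg assms)
  then show ?thesis by (metis frechet_derivative_ident)
qed

lemma coord_vec_in_tspace:
  assumes M: "smooth_atlas M" "c \<in> M" "p \<in> cdom c"
  shows "coord_vec M c p h \<in> tspace M p"
  unfolding tspace_def
proof (intro CollectI conjI ballI allI impI)
  fix c1 c2 assume c: "c1 \<in> M" "c2 \<in> M" "p \<in> cdom c1 \<inter> cdom c2"
  then show "coord_vec M c p h c2 =
      frechet_derivative (cmap c2 \<circ> cinv c1) (at (cmap c1 p)) (coord_vec M c p h c1)"
    using frechet_derivative_change_chart[OF M(1,2) c(1) M(3), of "cmap c2"]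
      transition_differentiable[OF M(1) c(1,2)]
    by (simp add: coord_vec_def)
qed (auto simp: coord_vec_def)

lemma coord_vec_self:
  assumes "smooth_atlas M" "c \<in> M" "p \<in> cdom c"
  shows "coord_vec M c p h c = h"
  using assms frechet_derivative_transition_self[OF assms] by (simp add: coord_vec_def)

lemma tspaceD:
  assumes "v \<in> tspace M p" "c \<in> M" "c' \<in> M" "p \<in> cdom c" "p \<in> cdom c'"
  shows "v c' = frechet_derivative (cmap c' \<circ> cinv c) (at (cmap c p)) (v c)"
  using assms unfolding tspace_def by blast

lemma tspace_zero: "v \<in> tspace M p \<Longrightarrow> \<not> (c \<in> M \<and> p \<in> cdom c) \<Longrightarrow> v c = 0"
  unfolding tspace_def by blast

lemma tspace_eqI:
  assumes "v \<in> tspace M p" "w \<in> tspace M p" "c \<in> M" "p \<in> cdom c" "v c = w c"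
  shows "v = w"
proof
  fix c'
  show "v c' = w c'"
  proof (cases "c' \<in> M \<and> p \<in> cdom c'")
    case True
    then show ?thesis
      using tspaceD[OF assms(1,3) _ assms(4)] tspaceD[OF assms(2,3) _ assms(4)] assms(5) by simp
  next
    case False
    then show ?thesis using tspace_zero[OF assms(1)] tspace_zero[OF assms(2)] by simp
  qed
qed

lemma linear_transition:
  assumes "smooth_atlas M" "c \<in> M" "c' \<in> M" "p \<in> cdom c" "p \<in> cdom c'"
  shows "linear (frechet_derivative (cmap c' \<circ> cinv c) (at (cmap c p)))"
  using transition_differentiable[OF assms] by (rule linear_frechet_derivative)

lemma tzero_in_tspace: "smooth_atlas M \<Longrightarrow> tzero \<in> tspace M p"
  unfolding tspace_def tzero_def by (simp add: linear_0[OF linear_transition])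

lemma tadd_in_tspace:
  assumes M: "smooth_atlas M" and v: "v \<in> tspace M p" and w: "w \<in> tspace M p"
  shows "tadd v w \<in> tspace M p"
  unfolding tspace_def
proof (intro CollectI conjI ballI allI impI)
  fix c c' assume c: "c \<in> M" "c' \<in> M" "p \<in> cdom c \<inter> cdom c'"
  then have p: "p \<in> cdom c" "p \<in> cdom c'" by auto
  show "tadd v w c' = frechet_derivative (cmap c' \<circ> cinv c) (at (cmap c p)) (tadd v w c)"
    unfolding tadd_def linear_add[OF linear_transition[OF M c(1,2) p]]
    by (simp only: tspaceD[OF v c(1,2) p, symmetric] tspaceD[OF w c(1,2) p, symmetric])
qed (simp add: tadd_def tspace_zero[OF v] tspace_zero[OF w])

lemma tscale_in_tspace:
  assumes M: "smooth_atlas M" and v: "v \<in> tspace M p"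
  shows "tscale r v \<in> tspace M p"
  unfolding tspace_def
proof (intro CollectI conjI ballI allI impI)
  fix c c' assume c: "c \<in> M" "c' \<in> M" "p \<in> cdom c \<inter> cdom c'"
  then have p: "p \<in> cdom c" "p \<in> cdom c'" by auto
  show "tscale r v c' = frechet_derivative (cmap c' \<circ> cinv c) (at (cmap c p)) (tscale r v c)"
    unfolding tscale_def linear_scale[OF linear_transition[OF M c(1,2) p]]
    by (simp only: tspaceD[OF v c(1,2) p, symmetric])
qed (simp add: tscale_def tspace_zero[OF v])

lemma chart_at: "p \<in> points M \<Longrightarrow> chart_at M p \<in> M \<and> p \<in> cdom (chart_at M p)"
  unfolding chart_at_def points_def by (rule someI_ex) blast

lemma dir_deriv_in_chart:
  assumes M: "smooth_atlas M" and \<phi>: "smooth_fun M \<phi>" and v: "v \<in> tspace M p"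
    and c: "c \<in> M" "p \<in> cdom c"
  shows "dir_deriv M \<phi> p v = frechet_derivative (\<phi> \<circ> cinv c) (at (cmap c p)) (v c)"
proof -
  have c': "chart_at M p \<in> M" "p \<in> cdom (chart_at M p)"
    using chart_at[of p M] c by (auto simp: points_def)
  have "(\<phi> \<circ> cinv c) differentiable (at (cmap c p))"
    using \<phi> c smooth_on_differentiable[OF _ cmap_in_cimg[OF c(2)]] by (auto simp: smooth_fun_def)
  from frechet_derivative_change_chart[OF M c'(1) c(1) c'(2) c(2) this]
  show ?thesis
    unfolding dir_deriv_def Let_def tspaceD[OF v c'(1) c(1) c'(2) c(2)] .
qed

section \<open>The slit tangent bundle\<close>

lemma cdom_slit_chart:
  "cdom (slit_chart M c) = {(p, v). p \<in> cdom c \<and> v \<in> tspace M p \<and> v \<noteq> tzero}"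
  by (simp add: slit_chart_def cdom_def)

lemma cmap_slit_chart: "cmap (slit_chart M c) b = (cmap c (fst b), snd b c)"
  by (simp add: slit_chart_def cmap_def case_prod_unfold)

text \<open>A nonzero tangent vector has nonzero coordinates in every chart, so the induced charts have
  product images with the punctured fibre as second factor.\<close>

lemma slit_chart_image:
  fixes M :: "('a, 'e::euclidean_space) chart set"
  assumes M: "smooth_atlas M" and c: "c \<in> M"
  shows "cmap (slit_chart M c) ` {b \<in> cdom (slit_chart M c). fst b \<in> U} =
    (cmap c ` (cdom c \<inter> U)) \<times> (- {0 :: 'e})"
proof (intro set_eqI iffI)
  fix z :: "'e \<times> 'e" assume "z \<in> cmap (slit_chart M c) ` {b \<in> cdom (slit_chart M c). fst b \<in> U}"
  then obtain p v where p: "p \<in> cdom c" "p \<in> U" and v: "v \<in> tspace M p" "v \<noteq> tzero"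
    and z: "z = (cmap c p, v c)"
    by (auto simp: cdom_slit_chart cmap_slit_chart)
  have "v c \<noteq> 0"
    using tspace_eqI[OF v(1) tzero_in_tspace[OF M] c p(1)] v(2) by (auto simp: tzero_def)
  then show "z \<in> (cmap c ` (cdom c \<inter> U)) \<times> (- {0})" using p z by blast
next
  fix z :: "'e \<times> 'e" assume "z \<in> (cmap c ` (cdom c \<inter> U)) \<times> (- {0})"
  then obtain p y where p: "p \<in> cdom c" "p \<in> U" and y: "y \<noteq> 0" and z: "z = (cmap c p, y)"
    by blast
  let ?b = "(p, coord_vec M c p y)"
  have "coord_vec M c p y \<noteq> tzero"
    using coord_vec_self[OF M c p(1), of y] y by (auto simp: tzero_def)
  then have "?b \<in> {b \<in> cdom (slit_chart M c). fst b \<in> U}"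
    using p coord_vec_in_tspace[OF M c p(1)] by (simp add: cdom_slit_chart)
  moreover have "z = cmap (slit_chart M c) ?b"
    by (simp add: cmap_slit_chart coord_vec_self[OF M c p(1)] z)
  ultimately show "z \<in> cmap (slit_chart M c) ` {b \<in> cdom (slit_chart M c). fst b \<in> U}"
    by (rule image_eqI[rotated])
qed

lemma cimg_slit_chart:
  assumes "smooth_atlas M" "c \<in> M"
  shows "cimg (slit_chart M c) = cimg c \<times> (- {0})"
  using slit_chart_image[OF assms, of UNIV] by (simp add: cimg_def)

lemma slit_overlap:
  "cdom (slit_chart M c) \<inter> cdom (slit_chart M c') = {b \<in> cdom (slit_chart M c). fst b \<in> cdom c'}"
  by (auto simp: cdom_slit_chart)

lemma inj_on_slit_chart:
  assumes M: "smooth_atlas M" and c: "c \<in> M"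
  shows "inj_on (cmap (slit_chart M c)) (cdom (slit_chart M c))"
proof (rule inj_onI)
  fix b b' assume b: "b \<in> cdom (slit_chart M c)" and b': "b' \<in> cdom (slit_chart M c)"
    and eq: "cmap (slit_chart M c) b = cmap (slit_chart M c) b'"
  obtain p v where bb: "b = (p, v)" by fastforce
  obtain p' v' where bb': "b' = (p', v')" by fastforce
  have p: "p \<in> cdom c" "v \<in> tspace M p" and p': "p' \<in> cdom c" "v' \<in> tspace M p'"
    using b b' by (auto simp: bb bb' cdom_slit_chart)
  have x: "cmap c p = cmap c p'" and y: "v c = v' c"
    using eq by (simp_all add: bb bb' cmap_slit_chart)
  have "p = p'" using x cinv_cmap[OF M c p(1)] cinv_cmap[OF M c p'(1)] by metis
  moreover from this have "v = v'" using p tspace_eqI[of v M p v' c] p'(2) c y by blast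
  ultimately show "b = b'" by (simp add: bb bb')
qed

lemma cinv_slit_chart:
  assumes M: "smooth_atlas M" and c: "c \<in> M" and b: "b \<in> cdom (slit_chart M c)"
  shows "cinv (slit_chart M c) (cmap (slit_chart M c) b) = b"
  unfolding cinv_def using inj_on_slit_chart[OF M c] b by simp

lemma fst_cinv_slit_chart:
  assumes M: "smooth_atlas M" and c: "c \<in> M" and z: "z \<in> cimg (slit_chart M c)"
  shows "fst (cinv (slit_chart M c) z) = cinv c (fst z)"
proof -
  obtain b where b: "b \<in> cdom (slit_chart M c)" and zb: "z = cmap (slit_chart M c) b"
    using z unfolding cimg_def by blast
  have "fst b \<in> cdom c" using b by (auto simp: cdom_slit_chart)
  then have "cinv c (fst z) = fst b" by (simp add: zb cmap_slit_chart cinv_cmap[OF M c])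
  then show ?thesis unfolding zb cinv_slit_chart[OF M c b] by simp
qed

text \<open>A coordinate change of the slit tangent bundle is the tangent map
  \<open>(x, y) \<mapsto> (\<tau> x, D\<tau>(x) y)\<close> of the coordinate change \<open>\<tau>\<close> of \<open>M\<close>.\<close>

lemma smooth_atlas_slit_tangent:
  fixes M :: "('a, 'e::euclidean_space) chart set"
  assumes M: "smooth_atlas M"
  shows "smooth_atlas (slit_tangent M)"
  unfolding smooth_atlas_def slit_tangent_def
proof (intro conjI ballI; elim imageE; hypsubst)
  fix c assume c: "c \<in> M"
  show "inj_on (cmap (slit_chart M c)) (cdom (slit_chart M c))"
    using M c by (rule inj_on_slit_chart)
  show "open (cimg (slit_chart M c))"
    unfolding cimg_slit_chart[OF M c] by (intro open_Times open_cimg[OF M c] open_Compl closed_singleton)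
next
  fix c c' assume c: "c \<in> M" and c': "c' \<in> M"
  let ?S = "cmap c ` (cdom c \<inter> cdom c') \<times> (- {0 :: 'e})"
  have S: "open ?S" by (intro open_Times open_overlap[OF M c c'] open_Compl closed_singleton)
  show "open (cmap (slit_chart M c) ` (cdom (slit_chart M c) \<inter> cdom (slit_chart M c')))"
    unfolding slit_overlap slit_chart_image[OF M c] by (rule S)
  have tm: "smooth_on ?S (\<lambda>(x, y). ((cmap c' \<circ> cinv c) x, frechet_derivative (cmap c' \<circ> cinv c) (at x) y))"
    by (intro smooth_on_tangent_map smooth_on_transition[OF M c c'] open_overlap[OF M c c']
        open_Compl closed_singleton)
  have eq: "(case z of (x, y) \<Rightarrow> ((cmap c' \<circ> cinv c) x, frechet_derivative (cmap c' \<circ> cinv c) (at x) y)) =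
      (cmap (slit_chart M c') \<circ> cinv (slit_chart M c)) z" if "z \<in> ?S" for z
  proof -
    have "z \<in> cmap (slit_chart M c) ` {b \<in> cdom (slit_chart M c). fst b \<in> cdom c'}"
      using that unfolding slit_chart_image[OF M c] .
    then obtain b' where b': "b' \<in> cdom (slit_chart M c)" "fst b' \<in> cdom c'"
      "z = cmap (slit_chart M c) b'" by blast
    obtain p v where "b' = (p, v)" by fastforce
    with b' have b: "(p, v) \<in> cdom (slit_chart M c)" "p \<in> cdom c'"
      and z: "z = cmap (slit_chart M c) (p, v)" by simp_all
    then have p: "p \<in> cdom c" "v \<in> tspace M p" by (auto simp: cdom_slit_chart)
    show ?thesis
      using tspaceD[OF p(2) c c' p(1) b(2), symmetric] cinv_slit_chart[OF M c b(1)]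
        cinv_cmap[OF M c p(1)]
      by (simp add: z cmap_slit_chart)
  qed
  show "smooth_on (cmap (slit_chart M c) ` (cdom (slit_chart M c) \<inter> cdom (slit_chart M c')))
      (cmap (slit_chart M c') \<circ> cinv (slit_chart M c))"
    unfolding slit_overlap slit_chart_image[OF M c] by (rule smooth_on_cong[OF S eq tm])
qed

lemma points_slit_tangent:
  "(p, v) \<in> points (slit_tangent M) \<longleftrightarrow> p \<in> points M \<and> v \<in> tspace M p \<and> v \<noteq> tzero"
  by (auto simp: points_def slit_tangent_def cdom_slit_chart)

text \<open>The bundle projection reads \<open>(x, y) \<mapsto> x\<close> in induced coordinates, so pulling a smooth
  map back to the slit tangent bundle composes its coordinate expression with \<open>fst\<close>.\<close>

lemma frechet_derivative_slit_chart:
  assumes M: "smooth_atlas M" and c: "c \<in> M" and b: "b \<in> cdom (slit_chart M c)"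
    and f: "(f \<circ> cinv c) differentiable (at (cmap c (fst b)))"
  shows "frechet_derivative (f \<circ> fst \<circ> cinv (slit_chart M c)) (at (cmap (slit_chart M c) b)) h =
    frechet_derivative (f \<circ> cinv c) (at (cmap c (fst b))) (fst h)"
proof -
  let ?z = "cmap (slit_chart M c) b" and ?g = "(f \<circ> cinv c) \<circ> fst"
  have z: "fst ?z = cmap c (fst b)" by (simp add: cmap_slit_chart)
  have fz: "(f \<circ> cinv c) differentiable (at (fst ?z))" unfolding z by (rule f)
  have der: "(fst has_derivative fst) (at ?z)"
    by (rule bounded_linear_imp_has_derivative[OF bounded_linear_fst])
  then have fst: "fst differentiable (at ?z)" "frechet_derivative fst (at ?z) = fst"
    using frechet_derivative_at[OF der] by (auto simp: differentiable_def)
  have "frechet_derivative ?g (at ?z) =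
      frechet_derivative (f \<circ> fst \<circ> cinv (slit_chart M c)) (at ?z)"
  proof (rule frechet_derivative_transform_within_open)
    show "?g differentiable (at ?z)" using fst(1) fz by (rule differentiable_chain_at)
    show "open (cimg (slit_chart M c))"
      using open_cimg[OF smooth_atlas_slit_tangent[OF M]] c by (simp add: slit_tangent_def)
    show "?z \<in> cimg (slit_chart M c)" using b by (rule cmap_in_cimg)
    show "?g z = (f \<circ> fst \<circ> cinv (slit_chart M c)) z" if "z \<in> cimg (slit_chart M c)" for z
      using fst_cinv_slit_chart[OF M c that] by simp
  qed
  then show ?thesis
    unfolding frechet_derivative_compose[OF fst(1) fz] fst(2) z by (metis comp_apply)
qed

lemma smooth_fun_fst:
  assumes M: "smooth_atlas M" and \<phi>: "smooth_fun M \<phi>"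
  shows "smooth_fun (slit_tangent M) (\<phi> \<circ> fst)"
  unfolding smooth_fun_def slit_tangent_def
proof (intro ballI; elim imageE; hypsubst)
  fix c assume c: "c \<in> M"
  have "smooth_on (cimg c \<times> (- {0})) (\<lambda>z. (\<phi> \<circ> cinv c) (fst z))"
    using \<phi> c unfolding smooth_fun_def
    by (intro smooth_on_fst open_cimg[OF M c] open_Compl closed_singleton) blast
  then have sm: "smooth_on (cimg (slit_chart M c)) (\<lambda>z. (\<phi> \<circ> cinv c) (fst z))"
    unfolding cimg_slit_chart[OF M c] .
  have op: "open (cimg (slit_chart M c))"
    using open_cimg[OF smooth_atlas_slit_tangent[OF M]] c by (simp add: slit_tangent_def)
  show "smooth_on (cimg (slit_chart M c)) (\<phi> \<circ> fst \<circ> cinv (slit_chart M c))"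
    by (rule smooth_on_cong[OF op _ sm]) (simp add: fst_cinv_slit_chart[OF M c])
qed

lemma smooth_section_lift_field:
  assumes M: "smooth_atlas M" and X: "vector_field M X"
  shows "smooth_section (slit_tangent M) M fst (lift_field X)"
  unfolding smooth_section_def
proof (intro conjI ballI)
  fix b assume "b \<in> points (slit_tangent M)"
  then show "lift_field X b \<in> tspace M (fst b)"
    using X by (cases b) (auto simp: lift_field_def smooth_section_def points_slit_tangent)
next
  fix d c assume d: "d \<in> slit_tangent M" and c: "c \<in> M"
  then obtain c' where c': "c' \<in> M" and dc: "d = slit_chart M c'"
    by (auto simp: slit_tangent_def)
  let ?S = "cmap c' ` (cdom c' \<inter> cdom c)"
  have S: "open ?S" using M c' c by (rule open_overlap)
  have eq: "X (cinv c' (fst z)) c = lift_field X (cinv d z) c" if "z \<in> ?S \<times> (- {0})" for z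
  proof -
    have "z \<in> cimg d"
      using that unfolding dc cimg_slit_chart[OF M c'] cimg_def[of c'] by blast
    then show ?thesis
      using fst_cinv_slit_chart[OF M c'] by (simp add: dc lift_field_def case_prod_unfold)
  qed
  have "smooth_on ?S (\<lambda>x. X (cinv c' x) c)"
    using X c c' by (simp add: smooth_section_def Int_def)
  then have "smooth_on (?S \<times> (- {0})) (\<lambda>z. X (cinv c' (fst z)) c)"
    by (rule smooth_on_fst[OF S, rotated]) auto
  then have "smooth_on (?S \<times> (- {0})) (\<lambda>z. lift_field X (cinv d z) c)"
    by (rule smooth_on_cong[rotated 2]) (auto simp: eq intro!: open_Times S)
  then show "smooth_on (cmap d ` {b \<in> cdom d. fst b \<in> cdom c}) (\<lambda>z. lift_field X (cinv d z) c)"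
    unfolding dc slit_chart_image[OF M c'] .
qed

text \<open>In the chart that defines \<open>differential\<close>, the projection keeps the \<open>x\<close>-components, which determine a
  coordinate vector of \<open>M\<close>.\<close>

lemma differential_fst_in_tspace:
  assumes M: "smooth_atlas M" and b: "b \<in> points (slit_tangent M)"
  shows "differential (slit_tangent M) M fst b \<xi> \<in> tspace M (fst b)"
proof -
  from chart_at[OF b] obtain c where c: "c \<in> M" and d: "chart_at (slit_tangent M) b = slit_chart M c"
    and bc: "b \<in> cdom (slit_chart M c)"
    by (auto simp: slit_tangent_def)
  have p: "fst b \<in> cdom c" using bc by (auto simp: cdom_slit_chart)
  have "differential (slit_tangent M) M fst b \<xi> = coord_vec M c (fst b) (fst (\<xi> (slit_chart M c)))"
    using frechet_derivative_slit_chart[OF M c bc transition_differentiable[OF M c _ p]]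
    by (auto simp: fun_eq_iff differential_def Let_def d coord_vec_def)
  then show ?thesis using coord_vec_in_tspace[OF M c p] by simp
qed

text \<open>The \<open>x\<close>-components of a tangent vector may be read off in any induced chart, not just in the one
  that defines \<open>differential\<close>.\<close>

lemma differential_fst:
  assumes M: "smooth_atlas M" and c: "c \<in> M" and b: "b \<in> cdom (slit_chart M c)"
    and \<xi>: "\<xi> \<in> tspace (slit_tangent M) b"
  shows "differential (slit_tangent M) M fst b \<xi> c = fst (\<xi> (slit_chart M c))"
proof -
  let ?B = "slit_tangent M"
  have "b \<in> points ?B" using b c by (auto simp: points_def slit_tangent_def)
  from chart_at[OF this] obtain c' where c': "c' \<in> M" and d: "chart_at ?B b = slit_chart M c'"
    and b': "b \<in> cdom (slit_chart M c')"
    by (auto simp: slit_tangent_def)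
  have p: "fst b \<in> cdom c" "fst b \<in> cdom c'" using b b' by (auto simp: cdom_slit_chart)
  have diff: "(cmap c \<circ> cinv c'') differentiable (at (cmap c'' (fst b)))" if "c'' \<in> M" "fst b \<in> cdom c''" for c''
    using transition_differentiable[OF M that(1) c that(2) p(1)] .
  have atl: "smooth_atlas ?B" using M by (rule smooth_atlas_slit_tangent)
  have mem: "slit_chart M c \<in> ?B" "slit_chart M c' \<in> ?B" using c c' by (auto simp: slit_tangent_def)
  have "differential ?B M fst b \<xi> c =
      frechet_derivative (cmap c \<circ> cinv c') (at (cmap c' (fst b))) (fst (\<xi> (slit_chart M c')))"
    using frechet_derivative_slit_chart[OF M c' b' diff[OF c' p(2)]]
    by (simp add: differential_def Let_def d c p)
  also have "\<dots> = fst (\<xi> (slit_chart M c))"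
  proof -
    let ?T = "frechet_derivative (cmap (slit_chart M c) \<circ> cinv (slit_chart M c'))
        (at (cmap (slit_chart M c') b))"
    have "\<xi> (slit_chart M c) = ?T (\<xi> (slit_chart M c'))"
      using tspaceD[OF \<xi> mem(2,1) b' b] .
    moreover have "fst (?T h) =
      frechet_derivative (cmap c \<circ> fst \<circ> cinv (slit_chart M c')) (at (cmap (slit_chart M c') b)) h" for h
    proof -
      have T: "((cmap (slit_chart M c) \<circ> cinv (slit_chart M c')) has_derivative ?T) (at (cmap (slit_chart M c') b))"
        using transition_differentiable[OF atl mem(2,1) b' b] by (simp only: frechet_derivative_works)
      have "((\<lambda>z. fst ((cmap (slit_chart M c) \<circ> cinv (slit_chart M c')) z)) has_derivative (\<lambda>h. fst (?T h)))
          (at (cmap (slit_chart M c') b))"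
        using T by (rule has_derivative_fst)
      moreover have "(\<lambda>z. fst ((cmap (slit_chart M c) \<circ> cinv (slit_chart M c')) z)) =
          cmap c \<circ> fst \<circ> cinv (slit_chart M c')"
        by (simp add: fun_eq_iff cmap_slit_chart)
      ultimately show ?thesis by (metis frechet_derivative_at)
    qed
    ultimately show ?thesis
      using frechet_derivative_slit_chart[OF M c' b' diff[OF c' p(2)]] by simp
  qed
  finally show ?thesis .
qed

section \<open>Restricting the Chern connection along a vector field\<close>

text \<open>The forms \<open>\<theta>\<^sup>i\<^sub>j\<close> contain no \<open>dy\<close>: evaluate \<open>dx\<^sup>j \<and> \<theta>\<^sup>i\<^sub>j = 0\<close> on a vertical vector and the
  coordinate vector \<open>\<partial>/\<partial>x\<^sup>j\<close>.\<close>

lemma chern_torsion_free_vertical: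
  fixes \<theta> :: "(real^'n) \<times> (real^'n) \<Rightarrow> (real^'n) \<times> (real^'n) \<Rightarrow> 'n \<Rightarrow> 'n \<Rightarrow> real"
  assumes "chern_torsion_free S \<theta>" and "z \<in> S" and "fst h = 0"
  shows "\<theta> z h i j = 0"
proof -
  have "(\<Sum>l\<in>UNIV. fst h $ l * \<theta> z (axis j 1, 0) i l - fst (axis j 1 :: real^'n, 0 :: real^'n) $ l * \<theta> z h i l) = 0"
    using assms(1,2) unfolding chern_torsion_free_def by blast
  moreover have "(\<Sum>l\<in>UNIV. axis j 1 $ l * \<theta> z h i l) = \<theta> z h i j"
    unfolding axis_def by (simp add: if_distrib if_distribR cong: if_cong)
  ultimately show ?thesis using assms(3) by (simp add: sum_negf)
qed

definition torsion_free_slit_connection ::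
  "('a, real^'n) chart set \<Rightarrow>
     ('a \<times> ('a, real^'n) tvec, (real^'n) \<times> (real^'n), 'a, real^'n) conn \<Rightarrow> bool" where
  "torsion_free_slit_connection M D \<longleftrightarrow>
     linear_connection (slit_tangent M) M fst D \<and>
     (\<forall>c\<in>M. \<exists>\<theta>. connection_forms (slit_tangent M) M fst D (slit_chart M c) c \<theta> \<and>
        chern_torsion_free (cimg (slit_chart M c)) \<theta>)"

text \<open>Connection forms act on sections of the pulled-back bundle; on a lifted field, whose components do
  not depend on \<open>y\<close>, the derivative term reduces to one on \<open>M\<close>.  The forms \<open>\<theta>\<close> are taken at the
  single point \<open>b\<close>.\<close>

lemma slit_connection_local:
  fixes M :: "('a, real^'n) chart set"
  assumes M: "smooth_atlas M" and D: "torsion_free_slit_connection M D"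
    and c: "c \<in> M" and b: "b \<in> cdom (slit_chart M c)"
  obtains \<theta> :: "(real^'n) \<times> (real^'n) \<Rightarrow> 'n \<Rightarrow> 'n \<Rightarrow> real" where
    "\<And>i j. linear (\<lambda>h. \<theta> h i j)"
    "\<And>h i j. fst h = 0 \<Longrightarrow> \<theta> h i j = 0"
    "\<And>h k i. (\<Sum>j\<in>UNIV. fst h $ j * \<theta> k i j) = (\<Sum>j\<in>UNIV. fst k $ j * \<theta> h i j)"
    "\<And>X \<xi> i. vector_field M X \<Longrightarrow> \<xi> \<in> tspace (slit_tangent M) b \<Longrightarrow>
       D (lift_field X) b \<xi> c $ i =
         frechet_derivative (\<lambda>x. X (cinv c x) c) (at (cmap c (fst b))) (fst (\<xi> (slit_chart M c))) $ i +
         (\<Sum>j\<in>UNIV. \<theta> (\<xi> (slit_chart M c)) i j * X (fst b) c $ j)"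
proof -
  let ?d = "slit_chart M c"
  obtain \<Theta> where forms: "connection_forms (slit_tangent M) M fst D ?d c \<Theta>"
    and tf: "chern_torsion_free (cimg ?d) \<Theta>"
    using D c unfolding torsion_free_slit_connection_def by blast
  let ?\<theta> = "\<Theta> (cmap ?d b)"
  have p: "fst b \<in> cdom c" using b by (auto simp: cdom_slit_chart)
  have z: "cmap ?d b \<in> cimg ?d" using b by (rule cmap_in_cimg)
  have img: "cmap ?d b \<in> cmap ?d ` {b \<in> cdom ?d. fst b \<in> cdom c}" using b p by blast
  show thesis
  proof (rule that[of ?\<theta>])
    show "linear (\<lambda>h. ?\<theta> h i j)" for i j
      using forms img unfolding connection_forms_def by blast
    show "?\<theta> h i j = 0" if "fst h = 0" for h i j
      using chern_torsion_free_vertical[OF tf z that] .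
    show "(\<Sum>j\<in>UNIV. fst h $ j * ?\<theta> k i j) = (\<Sum>j\<in>UNIV. fst k $ j * ?\<theta> h i j)" for h k i
    proof -
      have "(\<Sum>j\<in>UNIV. fst h $ j * ?\<theta> k i j - fst k $ j * ?\<theta> h i j) = 0"
        using tf z unfolding chern_torsion_free_def by blast
      then show ?thesis by (simp add: sum_subtractf)
    qed
    show "D (lift_field X) b \<xi> c $ i =
         frechet_derivative (\<lambda>x. X (cinv c x) c) (at (cmap c (fst b))) (fst (\<xi> ?d)) $ i +
         (\<Sum>j\<in>UNIV. ?\<theta> (\<xi> ?d) i j * X (fst b) c $ j)"
      if X: "vector_field M X" and \<xi>: "\<xi> \<in> tspace (slit_tangent M) b" for X \<xi> i
    proof -
      have "smooth_on (cimg c) (\<lambda>x. X (cinv c x) c)"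
        using X c unfolding smooth_section_def cimg_def by fastforce
      from smooth_on_differentiable[OF this cmap_in_cimg[OF p]]
      have diff: "(\<lambda>x. X (cinv c x) c) differentiable (at (cmap c (fst b)))" .
      let ?f = "\<lambda>p. X p c $ i"
      have der: "(?f \<circ> cinv c has_derivative
          (\<lambda>h. frechet_derivative (\<lambda>x. X (cinv c x) c) (at (cmap c (fst b))) h $ i))
          (at (cmap c (fst b)))"
        using bounded_linear.has_derivative[OF bounded_linear_vec_nth
            diff[unfolded frechet_derivative_works]] by (simp add: o_def)
      have "frechet_derivative (\<lambda>u. lift_field X (cinv ?d u) c $ i) (at (cmap ?d b)) (\<xi> ?d) =
          frechet_derivative (?f \<circ> fst \<circ> cinv ?d) (at (cmap ?d b)) (\<xi> ?d)"
        by (simp add: lift_field_def case_prod_unfold o_def)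
      also have "\<dots> = frechet_derivative (?f \<circ> cinv c) (at (cmap c (fst b))) (fst (\<xi> ?d))"
        by (rule frechet_derivative_slit_chart[OF M c b]) (use der in \<open>unfold differentiable_def, blast\<close>)
      also have "\<dots> = frechet_derivative (\<lambda>x. X (cinv c x) c) (at (cmap c (fst b))) (fst (\<xi> ?d)) $ i"
        using frechet_derivative_at[OF der] by metis
      finally show ?thesis
        using forms smooth_section_lift_field[OF M X] b p \<xi> unfolding connection_forms_def
        by (simp add: lift_field_def case_prod_unfold)
    qed
  qed
qed

lemma slit_connection_in_tspace:
  assumes M: "smooth_atlas M" and D: "torsion_free_slit_connection M D"
    and X: "vector_field M X" and b: "b \<in> points (slit_tangent M)"
    and \<xi>: "\<xi> \<in> tspace (slit_tangent M) b"
  shows "D (lift_field X) b \<xi> \<in> tspace M (fst b)"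
  using D smooth_section_lift_field[OF M X] b \<xi>
  unfolding torsion_free_slit_connection_def linear_connection_def by blast

text \<open>Two vectors with the same projection differ by a vertical one, on which the connection forms
  vanish; the derivative term sees the projection only.\<close>

lemma slit_connection_projection:
  assumes M: "smooth_atlas M" and D: "torsion_free_slit_connection M D"
    and X: "vector_field M X" and b: "b \<in> points (slit_tangent M)"
    and \<xi>: "\<xi> \<in> tspace (slit_tangent M) b" and \<eta>: "\<eta> \<in> tspace (slit_tangent M) b"
    and eq: "differential (slit_tangent M) M fst b \<xi> = differential (slit_tangent M) M fst b \<eta>"
  shows "D (lift_field X) b \<xi> = D (lift_field X) b \<eta>"
proof -
  obtain c where c: "c \<in> M" and bc: "b \<in> cdom (slit_chart M c)"
    using b by (auto simp: points_def slit_tangent_def)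
  let ?d = "slit_chart M c"
  have p: "fst b \<in> cdom c" using bc by (auto simp: cdom_slit_chart)
  have fst_eq: "fst (\<xi> ?d) = fst (\<eta> ?d)"
    using differential_fst[OF M c bc \<xi>] differential_fst[OF M c bc \<eta>] eq by simp
  obtain \<theta> where lin: "\<And>i j. linear (\<lambda>h. \<theta> h i j)"
    and vert: "\<And>h i j. fst h = 0 \<Longrightarrow> \<theta> h i j = 0"
    and "\<And>h k i. (\<Sum>j\<in>UNIV. fst h $ j * \<theta> k i j) = (\<Sum>j\<in>UNIV. fst k $ j * \<theta> h i j)"
    and loc: "\<And>X \<xi> i. vector_field M X \<Longrightarrow> \<xi> \<in> tspace (slit_tangent M) b \<Longrightarrow>
       D (lift_field X) b \<xi> c $ i =
         frechet_derivative (\<lambda>x. X (cinv c x) c) (at (cmap c (fst b))) (fst (\<xi> ?d)) $ i +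
         (\<Sum>j\<in>UNIV. \<theta> (\<xi> ?d) i j * X (fst b) c $ j)"
    by (rule slit_connection_local[OF M D c bc]) (rule that)
  have "\<theta> (\<xi> ?d) i j = \<theta> (\<eta> ?d) i j" for i j
    using linear_diff[OF lin, of "\<xi> ?d" "\<eta> ?d" i j] vert[of "\<xi> ?d - \<eta> ?d" i j] fst_eq by simp
  then have "D (lift_field X) b \<xi> c = D (lift_field X) b \<eta> c"
    by (simp add: vec_eq_iff loc[OF X \<xi>] loc[OF X \<eta>] fst_eq)
  then show ?thesis
    by (rule tspace_eqI[OF slit_connection_in_tspace[OF M D X b \<xi>]
          slit_connection_in_tspace[OF M D X b \<eta>] c p])
qed

lemma exists_lift_of_tangent_vector:
  assumes M: "smooth_atlas M" and b: "b \<in> points (slit_tangent M)" and v: "v \<in> tspace M (fst b)"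
  shows "\<exists>\<xi>. \<xi> \<in> tspace (slit_tangent M) b \<and> differential (slit_tangent M) M fst b \<xi> = v"
proof -
  obtain c where c: "c \<in> M" and bc: "b \<in> cdom (slit_chart M c)"
    using b by (auto simp: points_def slit_tangent_def)
  have p: "fst b \<in> cdom c" using bc by (auto simp: cdom_slit_chart)
  have atl: "smooth_atlas (slit_tangent M)" using M by (rule smooth_atlas_slit_tangent)
  have d: "slit_chart M c \<in> slit_tangent M" using c by (simp add: slit_tangent_def)
  \<comment> \<open>the \<open>y\<close>-components of a lift are free\<close>
  let ?\<xi> = "coord_vec (slit_tangent M) (slit_chart M c) b (v c, 0)"
  have \<xi>: "?\<xi> \<in> tspace (slit_tangent M) b" using atl d bc by (rule coord_vec_in_tspace)
  have "differential (slit_tangent M) M fst b ?\<xi> c = v c"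
    using differential_fst[OF M c bc \<xi>] coord_vec_self[OF atl d bc] by simp
  then have "differential (slit_tangent M) M fst b ?\<xi> = v"
    using tspace_eqI[OF _ v c p] differential_fst_in_tspace[OF M b] by blast
  with \<xi> show ?thesis by blast
qed

text \<open>The choice of a lift is made independently of the field to be differentiated, so that the
  rules for \<open>D\<close> in the field argument carry over with one and the same \<open>\<xi>\<close>.  It need not be linear in \<open>v\<close>.\<close>

definition lift_vector ::
  "('a, 'e::euclidean_space) chart set \<Rightarrow> 'a \<times> ('a, 'e) tvec \<Rightarrow> ('a, 'e) tvec \<Rightarrow>
     ('a \<times> ('a, 'e) tvec, 'e \<times> 'e) tvec" where
  "lift_vector M b v =
     (SOME \<xi>. \<xi> \<in> tspace (slit_tangent M) b \<and> differential (slit_tangent M) M fst b \<xi> = v)"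

lemma lift_vector:
  assumes "smooth_atlas M" and "b \<in> points (slit_tangent M)" and "v \<in> tspace M (fst b)"
  shows "lift_vector M b v \<in> tspace (slit_tangent M) b"
    and "differential (slit_tangent M) M fst b (lift_vector M b v) = v"
  using someI_ex[OF exists_lift_of_tangent_vector[OF assms]] unfolding lift_vector_def by blast+

lemma fst_lift_vector:
  assumes M: "smooth_atlas M" and c: "c \<in> M" and b: "b \<in> cdom (slit_chart M c)"
    and v: "v \<in> tspace M (fst b)"
  shows "fst (lift_vector M b v (slit_chart M c)) = v c"
proof -
  have "b \<in> points (slit_tangent M)" using b c by (auto simp: points_def slit_tangent_def)
  note lift = lift_vector[OF M this v]
  show ?thesis using differential_fst[OF M c b lift(1)] lift(2) by simp
qed

text \<open>The connection on \<open>M\<close> with Christoffel symbols \<open>\<Gamma>\<^sup>k\<^sub>i\<^sub>j(x, W(x))\<close>.\<close>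

definition restrict_along ::
  "('a, 'e::euclidean_space) chart set \<Rightarrow> ('a \<times> ('a, 'e) tvec, 'e \<times> 'e, 'a, 'e) conn \<Rightarrow>
     ('a \<Rightarrow> ('a, 'e) tvec) \<Rightarrow> ('a, 'e) affine_conn" where
  "restrict_along M D W X p v = D (lift_field X) (p, W p) (lift_vector M (p, W p) v)"

section \<open>The induced symplectic connection\<close>

context
  fixes M :: "('a, real^'n) chart set"
    and D :: "('a \<times> ('a, real^'n) tvec, (real^'n) \<times> (real^'n), 'a, real^'n) conn"
    and W :: "'a \<Rightarrow> ('a, real^'n) tvec"
  assumes M: "smooth_atlas M"
    and D: "torsion_free_slit_connection M D"
    and W: "vector_field M W"
    and W_nonzero: "\<forall>p\<in>points M. W p \<noteq> tzero"
begin

lemma W_in_slit: "p \<in> points M \<Longrightarrow> (p, W p) \<in> points (slit_tangent M)"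
  using W W_nonzero unfolding points_slit_tangent smooth_section_def by blast

lemma W_in_slit_chart:
  assumes c: "c \<in> M" and p: "p \<in> cdom c"
  shows "(p, W p) \<in> cdom (slit_chart M c)"
proof -
  have "p \<in> points M" using c p unfolding points_def by blast
  from W_in_slit[OF this] show ?thesis
    using p unfolding points_slit_tangent cdom_slit_chart by simp
qed

text \<open>With this, a lift suited to the situation can replace the arbitrary one of the definition.\<close>

lemma restrict_along_eq:
  assumes X: "vector_field M X" and p: "p \<in> points M"
    and \<xi>: "\<xi> \<in> tspace (slit_tangent M) (p, W p)"
    and proj: "differential (slit_tangent M) M fst (p, W p) \<xi> = v"
  shows "restrict_along M D W X p v = D (lift_field X) (p, W p) \<xi>"
proof -
  have v: "v \<in> tspace M (fst (p, W p))"
    using differential_fst_in_tspace[OF M W_in_slit[OF p]] proj by blast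
  show ?thesis
    unfolding restrict_along_def
    using slit_connection_projection[OF M D X W_in_slit[OF p] lift_vector(1)[OF M W_in_slit[OF p] v] \<xi>]
      lift_vector(2)[OF M W_in_slit[OF p] v] proj by simp
qed

lemma restrict_along_in_tspace:
  assumes X: "vector_field M X" and p: "p \<in> points M" and v: "v \<in> tspace M p"
  shows "restrict_along M D W X p v \<in> tspace M p"
proof -
  have "v \<in> tspace M (fst (p, W p))" using v by simp
  from slit_connection_in_tspace[OF M D X W_in_slit[OF p] lift_vector(1)[OF M W_in_slit[OF p] this]]
  show ?thesis unfolding restrict_along_def fst_conv .
qed

text \<open>The sum of the chosen lifts is a lift of the sum, though not the chosen one.\<close>

lemma restrict_along_add_vector:
  assumes X: "vector_field M X" and p: "p \<in> points M"
    and v: "v \<in> tspace M p" and w: "w \<in> tspace M p"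
  shows "restrict_along M D W X p (tadd v w) =
    tadd (restrict_along M D W X p v) (restrict_along M D W X p w)"
proof -
  let ?b = "(p, W p)" and ?B = "slit_tangent M"
  obtain c where c: "c \<in> M" and pc: "p \<in> cdom c" using p by (auto simp: points_def)
  note b = W_in_slit_chart[OF c pc] and bB = W_in_slit[OF p]
  have v': "v \<in> tspace M (fst ?b)" and w': "w \<in> tspace M (fst ?b)" using v w by simp_all
  let ?\<xi> = "lift_vector M ?b v" and ?\<eta> = "lift_vector M ?b w"
  note \<xi> = lift_vector(1)[OF M bB v'] and \<eta> = lift_vector(1)[OF M bB w']
  have sum: "tadd ?\<xi> ?\<eta> \<in> tspace ?B ?b"
    using smooth_atlas_slit_tangent[OF M] \<xi> \<eta> by (rule tadd_in_tspace)
  have "differential ?B M fst ?b (tadd ?\<xi> ?\<eta>) = tadd v w"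
  proof (rule tspace_eqI[OF _ _ c pc])
    show "differential ?B M fst ?b (tadd ?\<xi> ?\<eta>) \<in> tspace M p"
      using differential_fst_in_tspace[OF M bB] by simp
    show "tadd v w \<in> tspace M p" using M v w by (rule tadd_in_tspace)
    show "differential ?B M fst ?b (tadd ?\<xi> ?\<eta>) c = tadd v w c"
      unfolding differential_fst[OF M c b sum]
      by (simp add: tadd_def fst_lift_vector[OF M c b v'] fst_lift_vector[OF M c b w'])
  qed
  from restrict_along_eq[OF X p sum this]
  have "restrict_along M D W X p (tadd v w) = D (lift_field X) ?b (tadd ?\<xi> ?\<eta>)" .
  also have "\<dots> = tadd (D (lift_field X) ?b ?\<xi>) (D (lift_field X) ?b ?\<eta>)"
    using D smooth_section_lift_field[OF M X] bB \<xi> \<eta>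
    unfolding torsion_free_slit_connection_def linear_connection_def by blast
  finally show ?thesis by (simp only: restrict_along_def)
qed

lemma restrict_along_scale_vector:
  assumes X: "vector_field M X" and p: "p \<in> points M" and v: "v \<in> tspace M p"
  shows "restrict_along M D W X p (tscale r v) = tscale r (restrict_along M D W X p v)"
proof -
  let ?b = "(p, W p)" and ?B = "slit_tangent M"
  obtain c where c: "c \<in> M" and pc: "p \<in> cdom c" using p by (auto simp: points_def)
  note b = W_in_slit_chart[OF c pc] and bB = W_in_slit[OF p]
  have v': "v \<in> tspace M (fst ?b)" using v by simp
  let ?\<xi> = "lift_vector M ?b v"
  note \<xi> = lift_vector(1)[OF M bB v']
  have mult: "tscale r ?\<xi> \<in> tspace ?B ?b"
    using smooth_atlas_slit_tangent[OF M] \<xi> by (rule tscale_in_tspace)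
  have "differential ?B M fst ?b (tscale r ?\<xi>) = tscale r v"
  proof (rule tspace_eqI[OF _ _ c pc])
    show "differential ?B M fst ?b (tscale r ?\<xi>) \<in> tspace M p"
      using differential_fst_in_tspace[OF M bB] by simp
    show "tscale r v \<in> tspace M p" using M v by (rule tscale_in_tspace)
    show "differential ?B M fst ?b (tscale r ?\<xi>) c = tscale r v c"
      unfolding differential_fst[OF M c b mult]
      by (simp add: tscale_def fst_lift_vector[OF M c b v'])
  qed
  from restrict_along_eq[OF X p mult this]
  have "restrict_along M D W X p (tscale r v) = D (lift_field X) ?b (tscale r ?\<xi>)" .
  also have "\<dots> = tscale r (D (lift_field X) ?b ?\<xi>)"
    using D smooth_section_lift_field[OF M X] bB \<xi>
    unfolding torsion_free_slit_connection_def linear_connection_def by blast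
  finally show ?thesis by (simp only: restrict_along_def)
qed

text \<open>The arbitrary lifts need not vary smoothly.  Along the chart \<open>d\<close>, replace them by \<open>(h, 0)\<close> in induced
  coordinates; then the expression is that of \<open>D\<close>, composed with \<open>u \<mapsto> (u, W(u))\<close>.\<close>

lemma restrict_along_smooth:
  assumes X: "vector_field M X" and d: "d \<in> M" and c: "c \<in> M"
  shows "smooth_on (cmap d ` {p \<in> cdom d. p \<in> cdom c})
    (\<lambda>u. restrict_along M D W X (cinv d u) (coord_vec M d (cinv d u) h) c)"
proof -
  let ?B = "slit_tangent M" and ?d = "slit_chart M d"
  let ?T = "cmap d ` (cdom d \<inter> cdom c)" and ?S = "cmap ?d ` {b \<in> cdom ?d. fst b \<in> cdom c}"
  let ?G = "\<lambda>z. D (lift_field X) (cinv ?d z) (coord_vec ?B ?d (cinv ?d z) (h, 0)) c"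
  let ?w = "\<lambda>u. (u, W (cinv d u) d)"
  have T: "open ?T" using M d c by (rule open_overlap)
  have dB: "?d \<in> ?B" using d by (simp add: slit_tangent_def)
  have atl: "smooth_atlas ?B" using M by (rule smooth_atlas_slit_tangent)
  have overlap: "cinv d u \<in> cdom d" "cinv d u \<in> cdom c"
    and w_eq: "?w u = cmap ?d (cinv d u, W (cinv d u))" if "u \<in> ?T" for u
    using that cinv_cmap[OF M d] by (auto simp: cmap_slit_chart)
  have "smooth_on ?S ?G"
    using D smooth_section_lift_field[OF M X] dB c
    unfolding torsion_free_slit_connection_def linear_connection_def by blast
  moreover have "smooth_on ?T ?w"
  proof (rule smooth_on_Pair[OF smooth_on_linear[OF bounded_linear_ident] _ T])
    have "smooth_on (cmap d ` {p \<in> cdom d. p \<in> cdom d}) (\<lambda>u. W (cinv d u) d)"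
      using W d unfolding smooth_section_def by blast
    then show "smooth_on ?T (\<lambda>u. W (cinv d u) d)" by (rule smooth_on_subset) blast
  qed
  moreover have "?w ` ?T \<subseteq> ?S"
  proof (rule image_subsetI)
    fix u assume u: "u \<in> ?T"
    have "(cinv d u, W (cinv d u)) \<in> {b \<in> cdom ?d. fst b \<in> cdom c}"
      using overlap[OF u] W_in_slit_chart[OF d] by simp
    then show "?w u \<in> ?S" unfolding w_eq[OF u] by (rule imageI)
  qed
  ultimately have comp: "smooth_on ?T (\<lambda>u. ?G (?w u))"
    using T by (intro smooth_on_compose[of ?T ?w ?S ?G])
  have "?G (?w u) = restrict_along M D W X (cinv d u) (coord_vec M d (cinv d u) h) c"
    if u: "u \<in> ?T" for u
  proof -
    let ?p = "cinv d u"
    let ?b = "(?p, W ?p)" let ?\<xi> = "coord_vec ?B ?d ?b (h, 0)"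
    have pd: "?p \<in> cdom d" and wu: "?w u = cmap ?d ?b" using overlap[OF u] w_eq[OF u] by simp_all
    note b = W_in_slit_chart[OF d pd]
    have p: "?p \<in> points M" using pd d by (auto simp: points_def)
    have \<xi>: "?\<xi> \<in> tspace ?B ?b" using atl dB b by (rule coord_vec_in_tspace)
    have "differential ?B M fst ?b ?\<xi> = coord_vec M d ?p h"
    proof (rule tspace_eqI[OF _ coord_vec_in_tspace[OF M d pd] d pd])
      show "differential ?B M fst ?b ?\<xi> \<in> tspace M ?p"
        using differential_fst_in_tspace[OF M W_in_slit[OF p]] by simp
      show "differential ?B M fst ?b ?\<xi> d = coord_vec M d ?p h d"
        using differential_fst[OF M d b \<xi>] by (simp add: coord_vec_self[OF atl dB b] coord_vec_self[OF M d pd])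
    qed
    from restrict_along_eq[OF X p \<xi> this] show ?thesis
      by (simp only: wu cinv_slit_chart[OF M d b])
  qed
  then have "smooth_on ?T (\<lambda>u. restrict_along M D W X (cinv d u) (coord_vec M d (cinv d u) h) c)"
    by (rule smooth_on_cong[OF T _ comp])
  then show ?thesis by (simp only: Int_def Collect_mem_eq mem_Collect_eq)
qed

lemma restrict_along_add_field:
  assumes X: "vector_field M X" and Y: "vector_field M Y"
    and p: "p \<in> points M" and v: "v \<in> tspace M p"
  shows "restrict_along M D W (\<lambda>q. tadd (X q) (Y q)) p v =
    tadd (restrict_along M D W X p v) (restrict_along M D W Y p v)"
proof -
  have "lift_field (\<lambda>q. tadd (X q) (Y q)) = (\<lambda>b. tadd (lift_field X b) (lift_field Y b))"
    by (simp add: lift_field_def case_prod_unfold)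
  moreover have "v \<in> tspace M (fst (p, W p))" using v by simp
  from lift_vector(1)[OF M W_in_slit[OF p] this]
  have "D (\<lambda>b. tadd (lift_field X b) (lift_field Y b)) (p, W p) (lift_vector M (p, W p) v) =
      tadd (D (lift_field X) (p, W p) (lift_vector M (p, W p) v))
        (D (lift_field Y) (p, W p) (lift_vector M (p, W p) v))"
    using D smooth_section_lift_field[OF M X] smooth_section_lift_field[OF M Y] W_in_slit[OF p]
    unfolding torsion_free_slit_connection_def linear_connection_def by blast
  ultimately show ?thesis by (simp only: restrict_along_def)
qed

text \<open>The Leibniz rule of \<open>D\<close> is applied to \<open>\<phi> \<circ> fst\<close>, whose derivative along a lift of \<open>v\<close> is that of
  \<open>\<phi>\<close> along \<open>v\<close>.\<close>

lemma restrict_along_Leibniz: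
  assumes \<phi>: "smooth_fun M \<phi>" and X: "vector_field M X"
    and p: "p \<in> points M" and v: "v \<in> tspace M p"
  shows "restrict_along M D W (\<lambda>q. tscale (\<phi> q) (X q)) p v =
    tadd (tscale (dir_deriv M \<phi> p v) (X p)) (tscale (\<phi> p) (restrict_along M D W X p v))"
proof -
  let ?b = "(p, W p)" and ?B = "slit_tangent M"
  let ?\<xi> = "lift_vector M ?b v"
  obtain c where c: "c \<in> M" and pc: "p \<in> cdom c" using p by (auto simp: points_def)
  note b = W_in_slit_chart[OF c pc] and bB = W_in_slit[OF p]
  have v': "v \<in> tspace M (fst ?b)" using v by simp
  note \<xi> = lift_vector(1)[OF M bB v']
  have \<phi>': "smooth_fun ?B (\<phi> \<circ> fst)" using M \<phi> by (rule smooth_fun_fst)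
  have dB: "slit_chart M c \<in> ?B" using c by (simp add: slit_tangent_def)
  have diff: "(\<phi> \<circ> cinv c) differentiable (at (cmap c (fst ?b)))"
    using \<phi> c smooth_on_differentiable[OF _ cmap_in_cimg[OF pc]] by (auto simp: smooth_fun_def)
  have "dir_deriv ?B (\<phi> \<circ> fst) ?b ?\<xi> = dir_deriv M \<phi> p v"
    using dir_deriv_in_chart[OF smooth_atlas_slit_tangent[OF M] \<phi>' \<xi> dB b]
      frechet_derivative_slit_chart[OF M c b diff] fst_lift_vector[OF M c b v']
      dir_deriv_in_chart[OF M \<phi> v c pc] by simp
  moreover have "lift_field (\<lambda>q. tscale (\<phi> q) (X q)) = (\<lambda>b. tscale ((\<phi> \<circ> fst) b) (lift_field X b))"
    by (simp add: lift_field_def case_prod_unfold)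
  moreover have "D (\<lambda>b. tscale ((\<phi> \<circ> fst) b) (lift_field X b)) ?b ?\<xi> =
      tadd (tscale (dir_deriv ?B (\<phi> \<circ> fst) ?b ?\<xi>) (lift_field X ?b))
        (tscale ((\<phi> \<circ> fst) ?b) (D (lift_field X) ?b ?\<xi>))"
    using D smooth_section_lift_field[OF M X] \<phi>' bB \<xi>
    unfolding torsion_free_slit_connection_def linear_connection_def by blast
  ultimately show ?thesis
    unfolding restrict_along_def by (simp add: lift_field_def)
qed

lemma linear_connection_restrict_along: "linear_connection M M (\<lambda>p. p) (restrict_along M D W)"
  unfolding linear_connection_def
  by (intro conjI allI impI ballI; (elim conjE)?)
    (simp_all add: restrict_along_in_tspace restrict_along_add_vector restrict_along_scale_vector
      restrict_along_smooth restrict_along_add_field restrict_along_Leibniz)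

text \<open>The connection terms of \<open>\<nabla>\<^sub>X Y\<close> and \<open>\<nabla>\<^sub>Y X\<close> agree by the symmetry of the forms, and the derivative
  terms differ by the Lie bracket.\<close>

lemma torsion_free_restrict_along: "torsion_free M (restrict_along M D W)"
  unfolding torsion_free_def
proof (intro allI impI ballI; elim conjE)
  fix X Y p assume X: "vector_field M X" and Y: "vector_field M Y" and p: "p \<in> points M"
  have Xp: "X p \<in> tspace M p" and Yp: "Y p \<in> tspace M p"
    using X Y p by (auto simp: smooth_section_def)
  show "restrict_along M D W Y p (X p) =
      tadd (restrict_along M D W X p (Y p)) (lie_bracket M X Y p)"
  proof
    fix c
    show "restrict_along M D W Y p (X p) c =
        tadd (restrict_along M D W X p (Y p)) (lie_bracket M X Y p) c"
    proof (cases "c \<in> M \<and> p \<in> cdom c")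
      case False
      then show ?thesis
        using tspace_zero[OF restrict_along_in_tspace[OF X p Yp] False]
          tspace_zero[OF restrict_along_in_tspace[OF Y p Xp] False]
        by (auto simp: tadd_def lie_bracket_def)
    next
      case True
      then have c: "c \<in> M" and pc: "p \<in> cdom c" by auto
      let ?b = "(p, W p)" and ?d = "slit_chart M c"
      note b = W_in_slit_chart[OF c pc] and bB = W_in_slit[OF p]
      have Xb: "X p \<in> tspace M (fst ?b)" and Yb: "Y p \<in> tspace M (fst ?b)" using Xp Yp by simp_all
      note fX = fst_lift_vector[OF M c b Xb] and fY = fst_lift_vector[OF M c b Yb]
      obtain \<theta> where "\<And>i j. linear (\<lambda>h. \<theta> h i j)"
        and "\<And>h i j. fst h = 0 \<Longrightarrow> \<theta> h i j = 0"
        and sym: "\<And>h k i. (\<Sum>j\<in>UNIV. fst h $ j * \<theta> k i j) = (\<Sum>j\<in>UNIV. fst k $ j * \<theta> h i j)"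
        and loc: "\<And>X \<xi> i. vector_field M X \<Longrightarrow> \<xi> \<in> tspace (slit_tangent M) ?b \<Longrightarrow>
          D (lift_field X) ?b \<xi> c $ i =
            frechet_derivative (\<lambda>x. X (cinv c x) c) (at (cmap c (fst ?b))) (fst (\<xi> ?d)) $ i +
            (\<Sum>j\<in>UNIV. \<theta> (\<xi> ?d) i j * X (fst ?b) c $ j)"
        by (rule slit_connection_local[OF M D c b]) (rule that)
      have "(\<Sum>j\<in>UNIV. \<theta> (lift_vector M ?b (X p) ?d) i j * Y p c $ j) =
          (\<Sum>j\<in>UNIV. \<theta> (lift_vector M ?b (Y p) ?d) i j * X p c $ j)" for i
        using sym[of "lift_vector M ?b (Y p) ?d" "lift_vector M ?b (X p) ?d" i]
        by (simp add: fX fY mult.commute)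
      then show ?thesis
        using True
        by (simp add: vec_eq_iff restrict_along_def tadd_def lie_bracket_def fX fY
            loc[OF X lift_vector(1)[OF M bB Yb]] loc[OF Y lift_vector(1)[OF M bB Xb]])
    qed
  qed
qed

text \<open>Compatibility on the slit tangent bundle holds at each \<open>(p, v)\<close> separately; this is the case
  \<open>v = W p\<close>.\<close>

lemma preserves_form2_restrict_along:
  assumes "chern_preserves_form2 M \<omega> D"
  shows "preserves_form2 M \<omega> (restrict_along M D W)"
  unfolding preserves_form2_def
proof (intro allI impI ballI; elim conjE)
  fix X Y Z p assume X: "vector_field M X" and Y: "vector_field M Y" and Z: "vector_field M Z"
    and p: "p \<in> points M"
  have Zp: "Z p \<in> tspace M (fst (p, W p))" using Z p by (auto simp: smooth_section_def)
  show "dir_deriv M (\<lambda>q. \<omega> q (X q) (Y q)) p (Z p) =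
      \<omega> p (restrict_along M D W X p (Z p)) (Y p) + \<omega> p (X p) (restrict_along M D W Y p (Z p))"
    using assms X Y Z W_in_slit[OF p] lift_vector[OF M W_in_slit[OF p] Zp]
    unfolding chern_preserves_form2_def restrict_along_def by blast
qed

end

theorem theorem3p6:
  fixes M :: "('a, real^'n) chart set"
    and \<omega> :: "('a, real^'n) form2"
    and F :: "'a \<times> ('a, real^'n) tvec \<Rightarrow> real"
    and D :: "('a \<times> ('a, real^'n) tvec, (real^'n) \<times> (real^'n), 'a, real^'n) conn"
    and W :: "'a \<Rightarrow> ('a, real^'n) tvec"
  assumes "finslerian_symplectic_manifold M \<omega> F"
    and "chern_connection M F D"
    and "chern_preserves_form2 M \<omega> D"
    and "vector_field M W"
    and "\<forall>p\<in>points M. W p \<noteq> tzero"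
  shows "{conn. symplectic_connection M \<omega> conn} \<noteq> {} \<and> {conn. fedosov_manifold M \<omega> conn} \<noteq> {}"
proof -
  have symp: "symplectic_manifold M \<omega>" and M: "smooth_atlas M"
    using assms(1)
    by (auto simp: finslerian_symplectic_manifold_def symplectic_manifold_def smooth_manifold_def)
  have D: "torsion_free_slit_connection M D"
    using assms(2) unfolding chern_connection_def torsion_free_slit_connection_def by blast
  have "symplectic_connection M \<omega> (restrict_along M D W)"
    using linear_connection_restrict_along[OF M D assms(4,5)]
      torsion_free_restrict_along[OF M D assms(4,5)]
      preserves_form2_restrict_along[OF M D assms(4,5,3)]
    by (simp add: symplectic_connection_def)
  then show ?thesis using symp unfolding fedosov_manifold_def by blast
qed

end
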